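(* Let $d\ge2$ be a fixed integer and let $\delta>0$, $b\ne0$, $B>0$ be constants. There is a constant $A_0$ depending only on $d,\delta,b,B$ such that for every $A\ge A_0$ the following holds for all integers $n\ge2$. Let $w_1,\dots,w_n$ be real numbers with $\sum_{i=1}^n w_i=0$, $\sum_{i=1}^n w_i^2=1$, and $|w_i-w_j|\le\frac{1}{A\sqrt{\log n}}$ for all distinct $i,j$. Let $I\subset[n]$ with $|I|\ge\delta n$, and let $(v_1,\dots,v_n)$ be a real sequence with $$v_i=\frac{P_d(i)}{n^d}\quad\text{for all } i\in I$$ (and $v_i$ arbitrary for $i\notin I$), where $P_d$ is a real polynomial of degree $d$ with leading coefficient $b$ whose remaining coefficients may depend on $n$, such that $|v_i|\le B$ for all $i\in I$. Let $S_\pi=\sum_{i=1}^n w_iv_{\pi(i)}$, where $\pi$ is a uniformly random permutation of $[n]$. (a) There is a constant $K$ depending only on $A,B,d,\delta,b$ such that for every $L\in\mathbb{R}$, $$\mathbb{P}\Big(|S_\pi-L|\le\frac1n\Big)\le\frac Kn.$$ (b) If in addition $|v_i|\le\widetilde B$ for all $i\in[n]$, for some constant $\widetilde B>0$, then there are constants $K',c>0$ depending only on $A,B,\widetilde B,d,\delta,b$ such that for every $L\in\mathbb{R}$, $$\mathbb{P}\Big(|S_\pi-L|\le\frac1n\Big)\le\frac{K'}{n}e^{-cL^2}.$$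
   Context: $[n]=\{1,\dots,n\}$. *)

theory Defs
  imports "HOL-Probability.Probability" "HOL-Combinatorics.Permutations"
    "HOL-Computational_Algebra.Polynomial"
begin

text \<open>
  Sequences \<open>w\<^sub>1, \<dots>, w\<^sub>n\<close> and \<open>v\<^sub>1, \<dots>, v\<^sub>n\<close> are functions on \<open>nat\<close> of which only the values
  on \<open>{1..n}\<close> are ever used.
\<close>

definition random_perm :: "nat \<Rightarrow> (nat \<Rightarrow> nat) pmf" where
  "random_perm n = pmf_of_set {\<pi>. \<pi> permutes {1..n}}"

definition perm_sum :: "nat \<Rightarrow> (nat \<Rightarrow> real) \<Rightarrow> (nat \<Rightarrow> real) \<Rightarrow> (nat \<Rightarrow> nat) \<Rightarrow> real" where
  "perm_sum n w v \<pi> = (\<Sum>i = 1..n. w i * v (\<pi> i))"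

definition spread_weights :: "real \<Rightarrow> nat \<Rightarrow> (nat \<Rightarrow> real) \<Rightarrow> bool" where
  "spread_weights A n w \<longleftrightarrow>
     (\<Sum>i = 1..n. w i) = 0 \<and> (\<Sum>i = 1..n. (w i)\<^sup>2) = 1 \<and>
     (\<forall>i\<in>{1..n}. \<forall>j\<in>{1..n}. i \<noteq> j \<longrightarrow> \<bar>w i - w j\<bar> \<le> 1 / (A * sqrt (ln (real n))))"

text \<open>
  The polynomial is chosen after \<open>n\<close>, so its lower coefficients may depend on \<open>n\<close>;
  only the degree \<open>d\<close> and the leading coefficient \<open>b\<close> are prescribed.
\<close>

definition poly_on ::
    "nat \<Rightarrow> real \<Rightarrow> real \<Rightarrow> nat \<Rightarrow> nat set \<Rightarrow> (nat \<Rightarrow> real) \<Rightarrow> bool" where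
  "poly_on d b B n I v \<longleftrightarrow>
     (\<exists>P :: real poly. degree P = d \<and> lead_coeff P = b \<and>
        (\<forall>i\<in>I. v i = poly P (real i) / real n ^ d)) \<and>
     (\<forall>i\<in>I. \<bar>v i\<bar> \<le> B)"

end

theory Submission
  imports Defs
begin

text \<open>
  Fix disjoint pairs of positions and average over the swaps of their images. A pair with weight
  difference \<open>\<Delta>\<close> and values \<open>x, y\<close> contributes the factor \<open>cos (t \<Delta> (x - y) / 2)\<close> to the
  characteristic function at \<open>t\<close>. On \<open>I\<close> the values are \<open>Q (i / n)\<close> for a polynomial \<open>Q\<close> whose
  coefficients are bounded, because \<open>Q\<close> is bounded on a positive proportion of the grid; the weight
  condition makes the phase \<open>s Q (i / n)\<close>, \<open>s = t \<Delta> / 2\<close>, move by small steps for all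
  \<open>\<bar>t\<bar> \<le> n\<close>, so it cannot concentrate near a multiple of \<open>\<pi>\<close>. Hence a pair gains a factor
  \<open>1 - c min (1, s\<^sup>2)\<close> on average, uniformly over the images of the previous pairs. A pairing with
  \<open>\<Sum> \<Delta>\<^sup>2\<close> bounded below then yields decay \<open>exp (- c min (t\<^sup>2, A\<^sup>2 log n))\<close>, which for large
  \<open>A\<close> sums over integers \<open>\<bar>t\<bar> < n\<close> to a constant. For the Gaussian factor the same argument is
  run at the complex frequency \<open>a + i t\<close> with \<open>a\<close> proportional to \<open>L\<close>, as long as
  \<open>L\<^sup>2\<close> is at most a multiple of \<open>log n\<close>; beyond that the subgaussian tail alone suffices.
\<close>

section \<open>Sums over permutations\<close>

text \<open>Under the tilt the images of the pairs are no longer uniform, while the averaging over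
  the image of a pair needs the uniform law. Cauchy-Schwarz separates the two: the tilt becomes a
  moment generating function at \<open>2 * a\<close>, the oscillation a product under the uniform
  law. Before that, the real parts of the symmetrised factors are folded back into the sum, so that
  only a swap-invariant product remains to be separated. The scale \<open>sqrt (ln n)\<close> enters
  twice. It caps the useful frequency: beyond \<open>A * sqrt (ln n)\<close> only the gain at the
  cap is kept, and the plateau, \<open>n\<close> to the power \<open>- c * A^2\<close>, is harmless
  once \<open>c * A^2 \<ge> 1\<close>. It also caps the tilt: comparing a tilted factor with its
  real counterpart requires a bounded real exponent on each pair, hence \<open>|a|\<close> of order
  \<open>sqrt (ln n)\<close>. This is why the range of \<open>L\<close> has to be split.\<close>

definition Perms :: "nat \<Rightarrow> (nat \<Rightarrow> nat) set" where
  "Perms n = {\<pi>. \<pi> permutes {1..n}}"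

lemma finite_Perms [simp]: "finite (Perms n)"
  by (simp add: Perms_def finite_permutations)

lemma card_Perms: "card (Perms n) = fact n"
  by (simp add: Perms_def card_permutations)

lemma sum_Perms_comp:
  assumes "\<rho> permutes {1..n}"
  shows "(\<Sum>\<pi>\<in>Perms n. f (\<pi> \<circ> \<rho>)) = (\<Sum>\<pi>\<in>Perms n. f \<pi>)"
  unfolding Perms_def using sum_permutations_compose_right[OF assms, of f] by simp

lemma Perms_in: "\<pi> \<in> Perms n \<Longrightarrow> i \<in> {1..n} \<Longrightarrow> \<pi> i \<in> {1..n}"
  unfolding Perms_def using permutes_in_image by fastforce

text \<open>The images of two positions outside \<open>U\<close> are exchangeable: \<open>G\<close>
  does not see rearrangements off \<open>U\<close>, so precomposing with a permutation of the
  complement that carries \<open>(a, b)\<close> to \<open>(x, y)\<close> reindexes one sum into the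
  other.\<close>

lemma sum_Perms_pair_eq:
  fixes G :: "(nat \<Rightarrow> nat) \<Rightarrow> real"
  assumes U: "U \<subseteq> {1..n}"
    and G: "\<And>\<pi> \<rho>. \<pi> \<in> Perms n \<Longrightarrow> \<rho> permutes ({1..n} - U) \<Longrightarrow> G (\<pi> \<circ> \<rho>) = G \<pi>"
    and "a \<in> {1..n} - U" "b \<in> {1..n} - U" "a \<noteq> b" "x \<in> {1..n} - U" "y \<in> {1..n} - U" "x \<noteq> y"
  shows "(\<Sum>\<pi>\<in>Perms n. G \<pi> * h (\<pi> x) (\<pi> y)) = (\<Sum>\<pi>\<in>Perms n. G \<pi> * h (\<pi> a) (\<pi> b))"
proof -
  \<comment> \<open>\<open>c\<close> is where the first transposition puts \<open>b\<close>. It is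
    \<open>a\<close> when \<open>b = x\<close>, so sending \<open>c\<close> rather than
    \<open>b\<close> to \<open>y\<close> covers that case too.\<close>
  define c where "c = Transposition.transpose a x b"
  have c: "c \<in> {1..n} - U" "c \<noteq> x" using assms by (auto simp: c_def Transposition.transpose_def)
  define \<rho> where "\<rho> = Transposition.transpose c y \<circ> Transposition.transpose a x"
  have p: "\<rho> permutes ({1..n} - U)"
    unfolding \<rho>_def using assms c by (intro permutes_compose permutes_swap_id) auto
  have ra: "\<rho> a = x" "\<rho> b = y" using c assms by (auto simp: \<rho>_def c_def Transposition.transpose_def)
  have "(\<Sum>\<pi>\<in>Perms n. G \<pi> * h (\<pi> a) (\<pi> b)) = (\<Sum>\<pi>\<in>Perms n. G (\<pi> \<circ> \<rho>) * h ((\<pi> \<circ> \<rho>) a) ((\<pi> \<circ> \<rho>) b))"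
    by (rule sum_Perms_comp[symmetric, where f = "\<lambda>\<pi>. G \<pi> * h (\<pi> a) (\<pi> b)"])
      (rule permutes_subset[OF p], auto)
  also have "\<dots> = (\<Sum>\<pi>\<in>Perms n. G \<pi> * h (\<pi> x) (\<pi> y))"
    by (intro sum.cong refl) (simp add: G[OF _ p] ra)
  finally show ?thesis by simp
qed

text \<open>By exchangeability all ordered pairs of distinct free positions contribute equally, and
  there are at most \<open>n^2\<close> of them. For a fixed \<open>\<pi>\<close> the double sum over
  free positions is one over the values outside the image of \<open>U\<close>, where
  \<open>avg\<close> applies pointwise. The diagonal vanishes by \<open>h x x = 0\<close>.\<close>

lemma sum_Perms_pair_average:
  fixes G :: "(nat \<Rightarrow> nat) \<Rightarrow> real" and h :: "nat \<Rightarrow> nat \<Rightarrow> real"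
  assumes U: "U \<subseteq> {1..n}"
    and G: "\<And>\<pi> \<rho>. \<pi> \<in> Perms n \<Longrightarrow> \<rho> permutes ({1..n} - U) \<Longrightarrow> G (\<pi> \<circ> \<rho>) = G \<pi>"
    and G0: "\<And>\<pi>. \<pi> \<in> Perms n \<Longrightarrow> 0 \<le> G \<pi>"
    and h0: "\<And>x y. 0 \<le> h x y" "\<And>x. h x x = 0"
    and ab: "a \<in> {1..n} - U" "b \<in> {1..n} - U" "a \<noteq> b"
    and avg: "\<And>\<pi>. \<pi> \<in> Perms n \<Longrightarrow> c \<le> (\<Sum>x\<in>{1..n}-\<pi>`U. \<Sum>y\<in>{1..n}-\<pi>`U. h x y)"
  shows "c * (\<Sum>\<pi>\<in>Perms n. G \<pi>) \<le> (real n)\<^sup>2 * (\<Sum>\<pi>\<in>Perms n. G \<pi> * h (\<pi> a) (\<pi> b))"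
proof -
  define C where "C = {1..n} - U"
  define X where "X = (\<Sum>\<pi>\<in>Perms n. G \<pi> * h (\<pi> a) (\<pi> b))"
  have X0: "0 \<le> X" unfolding X_def using G0 h0 by (intro sum_nonneg) auto
  have "c * (\<Sum>\<pi>\<in>Perms n. G \<pi>) = (\<Sum>\<pi>\<in>Perms n. G \<pi> * c)" by (simp add: sum_distrib_left mult.commute)
  also have "\<dots> \<le> (\<Sum>\<pi>\<in>Perms n. G \<pi> * (\<Sum>x\<in>C. \<Sum>y\<in>C. h (\<pi> x) (\<pi> y)))"
  proof (intro sum_mono mult_left_mono G0)
    fix \<pi> assume \<pi>: "\<pi> \<in> Perms n"
    then have per: "\<pi> permutes {1..n}" by (simp add: Perms_def)
    have inj: "inj_on \<pi> A" for A using permutes_inj_on[OF per] .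
    have img: "\<pi> ` C = {1..n} - \<pi> ` U"
      unfolding C_def using permutes_image[OF per] inj[of UNIV] by (metis image_set_diff)
    have "(\<Sum>x\<in>C. \<Sum>y\<in>C. h (\<pi> x) (\<pi> y)) = (\<Sum>x\<in>\<pi>`C. \<Sum>y\<in>\<pi>`C. h x y)"
      by (simp add: sum.reindex[OF inj])
    then show "c \<le> (\<Sum>x\<in>C. \<Sum>y\<in>C. h (\<pi> x) (\<pi> y))" using avg[OF \<pi>] by (simp add: img)
  qed
  also have "\<dots> = (\<Sum>\<pi>\<in>Perms n. \<Sum>x\<in>C. \<Sum>y\<in>C. G \<pi> * h (\<pi> x) (\<pi> y))"
    by (simp add: sum_distrib_left)
  also have "\<dots> = (\<Sum>x\<in>C. \<Sum>\<pi>\<in>Perms n. \<Sum>y\<in>C. G \<pi> * h (\<pi> x) (\<pi> y))"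
    by (rule sum.swap)
  also have "\<dots> = (\<Sum>x\<in>C. \<Sum>y\<in>C. \<Sum>\<pi>\<in>Perms n. G \<pi> * h (\<pi> x) (\<pi> y))"
    by (intro sum.cong refl sum.swap)
  also have "\<dots> \<le> (\<Sum>x\<in>C. \<Sum>y\<in>C. X)"
  proof (intro sum_mono)
    fix x y assume xy: "x \<in> C" "y \<in> C"
    show "(\<Sum>\<pi>\<in>Perms n. G \<pi> * h (\<pi> x) (\<pi> y)) \<le> X"
    proof (cases "x = y")
      case True
      then show ?thesis using X0 h0 by simp
    next
      case False
      show ?thesis unfolding X_def
        by (rule eq_refl, rule sum_Perms_pair_eq[OF U G ab]) (use xy False in \<open>auto simp: C_def\<close>)
    qed
  qed
  also have "\<dots> = (real (card C))\<^sup>2 * X" by (simp add: power2_eq_square)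
  also have "\<dots> \<le> (real n)\<^sup>2 * X"
  proof -
    have "card C \<le> n" using card_mono[of "{1..n}" C] by (auto simp: C_def)
    then show ?thesis using X0 by (intro mult_right_mono power_mono) auto
  qed
  finally show ?thesis by (simp add: X_def)
qed

text \<open>The pairs are not independent, but \<open>avg\<close> holds for every set
  \<open>W\<close> of at most \<open>2 * m\<close> values already taken. So whatever the earlier
  images are, the next factor has average at most \<open>1 - \<eta> k\<close>, and revealing the
  pairs one by one gives the product that independence would give.\<close>

lemma prod_pairs_bound:
  fixes f :: "nat \<Rightarrow> nat \<Rightarrow> nat \<Rightarrow> real" and p :: "nat \<Rightarrow> nat"
  assumes n: "n \<ge> 1" and p: "inj_on p {..<2*m}" "p ` {..<2*m} \<subseteq> {1..n}"
    and f: "\<And>k x y. 0 \<le> f k x y" "\<And>k x y. f k x y \<le> 1" "\<And>k x. f k x x = 1"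
    and avg: "\<And>k W. k < m \<Longrightarrow> W \<subseteq> {1..n} \<Longrightarrow> card W \<le> 2 * m \<Longrightarrow>
      \<eta> k * (real n)\<^sup>2 \<le> (\<Sum>x\<in>{1..n}-W. \<Sum>y\<in>{1..n}-W. 1 - f k x y)"
    and \<eta>: "\<And>k. k < m \<Longrightarrow> \<eta> k \<le> 1"
  shows "(\<Sum>\<pi>\<in>Perms n. \<Prod>k<m. f k (\<pi> (p (2*k))) (\<pi> (p (2*k+1)))) \<le> fact n * (\<Prod>k<m. 1 - \<eta> k)"
proof -
  define G where "G j \<pi> = (\<Prod>k<j. f k (\<pi> (p (2*k))) (\<pi> (p (2*k+1))))" for j and \<pi> :: "nat \<Rightarrow> nat"
  have "(\<Sum>\<pi>\<in>Perms n. G j \<pi>) \<le> fact n * (\<Prod>k<j. 1 - \<eta> k)" if "j \<le> m" for j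
    using that
  proof (induction j)
    case 0
    then show ?case by (simp add: G_def card_Perms)
  next
    case (Suc j)
    define U where "U = p ` {..<2*j}"
    have U: "U \<subseteq> {1..n}" using p(2) Suc.prems by (force simp: U_def)
    \<comment> \<open>The amount removed by the next factor: the sum for \<open>Suc j\<close> is the
      sum for \<open>j\<close> minus \<open>X\<close>.\<close>
    define X where "X = (\<Sum>\<pi>\<in>Perms n. G j \<pi> * (1 - f j (\<pi> (p (2*j))) (\<pi> (p (2*j+1)))))"
    have "\<eta> j * (real n)\<^sup>2 * (\<Sum>\<pi>\<in>Perms n. G j \<pi>) \<le> (real n)\<^sup>2 * X"
      unfolding X_def
    proof (rule sum_Perms_pair_average[OF U])
      fix \<pi> \<rho> assume \<pi>: "\<pi> \<in> Perms n" and \<rho>: "\<rho> permutes ({1..n} - U)"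
      have "\<rho> (p i) = p i" if "i < 2 * j" for i
        using permutes_not_in[OF \<rho>, of "p i"] that by (auto simp: U_def)
      then show "G j (\<pi> \<circ> \<rho>) = G j \<pi>" unfolding G_def by (intro prod.cong refl) simp
    next
      fix \<pi> assume \<pi>: "\<pi> \<in> Perms n"
      show "0 \<le> G j \<pi>" unfolding G_def by (intro prod_nonneg) (simp add: f)
      have per: "\<pi> permutes {1..n}" using \<pi> by (simp add: Perms_def)
      show "\<eta> j * (real n)\<^sup>2 \<le> (\<Sum>x\<in>{1..n}-\<pi>`U. \<Sum>y\<in>{1..n}-\<pi>`U. 1 - f j x y)"
      proof (rule avg)
        show "\<pi> ` U \<subseteq> {1..n}" using U permutes_image[OF per] by blast
        have "card (\<pi> ` U) \<le> card U" by (rule card_image_le) (simp add: U_def)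
        also have "card U \<le> card {..<2*j}" unfolding U_def by (rule card_image_le) simp
        finally show "card (\<pi> ` U) \<le> 2 * m" using Suc.prems by simp
      qed (use Suc.prems in auto)
    next
      have notU: "p i \<notin> U" if "2 * j \<le> i" "i < 2 * m" for i
      proof
        assume "p i \<in> U"
        then obtain l where "l < 2 * j" "p l = p i" by (auto simp: U_def)
        then show False using inj_onD[OF p(1), of l i] that by auto
      qed
      show "p (2*j) \<in> {1..n} - U" "p (2*j+1) \<in> {1..n} - U"
        using notU[of "2*j"] notU[of "2*j+1"] image_subset_iff[THEN iffD1, OF p(2)] Suc.prems by auto
      show "p (2*j) \<noteq> p (2*j+1)" using inj_onD[OF p(1), of "2*j" "2*j+1"] Suc.prems by auto
    qed (use f in auto)
    then have "(real n)\<^sup>2 * (\<eta> j * (\<Sum>\<pi>\<in>Perms n. G j \<pi>)) \<le> (real n)\<^sup>2 * X" by (simp add: mult_ac)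
    then have X: "\<eta> j * (\<Sum>\<pi>\<in>Perms n. G j \<pi>) \<le> X" using n by (simp add: mult_le_cancel_left)
    have "(\<Sum>\<pi>\<in>Perms n. G (Suc j) \<pi>) = (\<Sum>\<pi>\<in>Perms n. G j \<pi>) - X"
      unfolding X_def sum_subtractf[symmetric] by (intro sum.cong refl) (simp add: G_def algebra_simps)
    also have "\<dots> \<le> (1 - \<eta> j) * (\<Sum>\<pi>\<in>Perms n. G j \<pi>)" using X by (simp add: algebra_simps)
    also have "\<dots> \<le> (1 - \<eta> j) * (fact n * (\<Prod>k<j. 1 - \<eta> k))"
      using Suc \<eta>[of j] by (intro mult_left_mono) auto
    finally show ?case by (simp add: mult_ac)
  qed
  from this[of m] show ?thesis by (simp add: G_def)
qed

text \<open>Probabilistic method: in a uniformly random ordering each consecutive pair has expected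
  squared difference at least \<open>2 / n\<close>, since over all ordered pairs the squared
  differences sum to \<open>2 * n\<close>. Some ordering reaches the average.\<close>

lemma exists_spread_pairing:
  fixes w :: "nat \<Rightarrow> real"
  assumes "n \<ge> 2" "2 * m \<le> n" "(\<Sum>i=1..n. w i) = 0" "(\<Sum>i=1..n. (w i)\<^sup>2) = 1"
  shows "\<exists>p. inj_on p {..<2*m} \<and> p ` {..<2*m} \<subseteq> {1..n} \<and>
    (\<Sum>k<m. (w (p (2*k)) - w (p (2*k+1)))\<^sup>2) \<ge> 2 * real m / real n"
proof -
  define F where "F \<sigma> = (\<Sum>k<m. (w (\<sigma> (2*k+1)) - w (\<sigma> (2*k+2)))\<^sup>2)" for \<sigma> :: "nat \<Rightarrow> nat"
  have tot: "(\<Sum>x\<in>{1..n}. \<Sum>y\<in>{1..n}. (w x - w y)\<^sup>2) = 2 * real n"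
  proof -
    have "(\<Sum>x\<in>{1..n}. \<Sum>y\<in>{1..n}. (w x - w y)\<^sup>2)
      = (\<Sum>x\<in>{1..n}. \<Sum>y\<in>{1..n}. (w x)\<^sup>2 + (w y)\<^sup>2 - 2 * w x * w y)"
      by (simp add: power2_diff)
    also have "\<dots> = (\<Sum>x\<in>{1..n}. real n * (w x)\<^sup>2 + 1)"
      using assms by (simp add: sum.distrib sum_subtractf sum_distrib_left[symmetric])
    also have "\<dots> = 2 * real n" using assms by (simp add: sum.distrib sum_distrib_left[symmetric])
    finally show ?thesis .
  qed
  have one: "2 * fact n / real n \<le> (\<Sum>\<sigma>\<in>Perms n. (w (\<sigma> (2*k+1)) - w (\<sigma> (2*k+2)))\<^sup>2)" if "k < m" for k
  proof -
    have "2 * real n * (\<Sum>\<sigma>\<in>Perms n. 1) \<le> (real n)\<^sup>2 * (\<Sum>\<sigma>\<in>Perms n. 1 * (w (\<sigma> (2*k+1)) - w (\<sigma> (2*k+2)))\<^sup>2)"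
      by (rule sum_Perms_pair_average[where U = "{}" and h = "\<lambda>x y. (w x - w y)\<^sup>2"])
        (use that assms tot in auto)
    then show ?thesis using assms(1) by (simp add: card_Perms power2_eq_square field_simps)
  qed
  have "2 * real m / real n * (\<Sum>\<sigma>\<in>Perms n. 1) = (\<Sum>k<m. 2 * fact n / real n)" by (simp add: card_Perms)
  also have "\<dots> \<le> (\<Sum>k<m. \<Sum>\<sigma>\<in>Perms n. (w (\<sigma> (2*k+1)) - w (\<sigma> (2*k+2)))\<^sup>2)" by (intro sum_mono one) simp
  also have "\<dots> = (\<Sum>\<sigma>\<in>Perms n. F \<sigma>)" unfolding F_def by (rule sum.swap)
  finally have le: "(\<Sum>\<sigma>\<in>Perms n. 2 * real m / real n) \<le> (\<Sum>\<sigma>\<in>Perms n. F \<sigma>)"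
    by (simp add: mult.commute)
  have "Perms n \<noteq> {}" using card_Perms[of n] by (metis card.empty fact_nonzero)
  have "\<exists>\<sigma>\<in>Perms n. 2 * real m / real n \<le> F \<sigma>"
  proof (rule ccontr)
    assume "\<not> ?thesis"
    then have "(\<Sum>\<sigma>\<in>Perms n. F \<sigma>) < (\<Sum>\<sigma>\<in>Perms n. 2 * real m / real n)"
      using \<open>Perms n \<noteq> {}\<close> by (intro sum_strict_mono) auto
    with le show False by simp
  qed
  then obtain \<sigma> where \<sigma>: "\<sigma> \<in> Perms n" "2 * real m / real n \<le> F \<sigma>" by blast
  have per: "\<sigma> permutes {1..n}" using \<sigma> by (simp add: Perms_def)
  show ?thesis
  proof (intro exI[of _ "\<lambda>i. \<sigma> (i + 1)"] conjI)
    show "inj_on (\<lambda>i. \<sigma> (i + 1)) {..<2*m}"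
      using permutes_inj[OF per] by (auto simp: inj_on_def inj_def)
    show "(\<lambda>i. \<sigma> (i + 1)) ` {..<2*m} \<subseteq> {1..n}" using Perms_in[OF \<sigma>(1)] assms(2) by fastforce
    show "2 * real m / real n \<le> (\<Sum>k<m. (w (\<sigma> (2*k + 1)) - w (\<sigma> (2*k+1 + 1)))\<^sup>2)"
      using \<sigma>(2) by (simp add: F_def)
  qed
qed

lemma perm_sum_transpose:
  assumes "a \<in> {1..n}" "b \<in> {1..n}"
  shows "perm_sum n w v (\<pi> \<circ> Transposition.transpose a b) = perm_sum n w v \<pi> - (w a - w b) * (v (\<pi> a) - v (\<pi> b))"
proof (cases "a = b")
  case False
  have split: "(\<Sum>i\<in>{1..n}. g i) = g a + g b + (\<Sum>i\<in>{1..n} - {a,b}. g i)" for g :: "nat \<Rightarrow> real"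
  proof -
    have "(\<Sum>i\<in>{1..n}. g i) = (\<Sum>i\<in>{a,b}. g i) + (\<Sum>i\<in>{1..n} - {a,b}. g i)"
      using assms by (subst sum.subset_diff[of "{a,b}"]) auto
    then show ?thesis using False by simp
  qed
  have "(\<Sum>i\<in>{1..n} - {a,b}. w i * v (\<pi> (Transposition.transpose a b i))) = (\<Sum>i\<in>{1..n} - {a,b}. w i * v (\<pi> i))"
    by (intro sum.cong refl) (auto simp: Transposition.transpose_def)
  then show ?thesis unfolding perm_sum_def split o_def by (simp add: algebra_simps)
qed simp

section \<open>Polynomials on a grid\<close>

text \<open>Greedy choice: keep the minimum and discard the window of \<open>g\<close> integers
  starting there. This costs at most \<open>g\<close> elements, and every survivor is at distance at
  least \<open>g\<close>.\<close>

lemma separated_subset: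
  fixes X :: "nat set"
  assumes "finite X" "card X > d * g" "g > 0"
  shows "\<exists>Y\<subseteq>X. card Y = Suc d \<and> (\<forall>x\<in>Y. \<forall>y\<in>Y. x \<noteq> y \<longrightarrow> real g \<le> \<bar>real x - real y\<bar>)"
  using assms
proof (induction d arbitrary: X)
  case 0
  then obtain x where "x \<in> X" by fastforce
  then show ?case by (intro exI[of _ "{x}"]) auto
next
  case (Suc d)
  from Suc.prems have ne: "X \<noteq> {}" by auto
  define a where "a = Min X"
  define X' where "X' = X \<inter> {a+g..}"
  have aX: "a \<in> X" and amin: "\<And>x. x \<in> X \<Longrightarrow> a \<le> x"
    using Suc.prems ne by (auto simp: a_def)
  have "X \<subseteq> X' \<union> {a..<a+g}" using amin by (auto simp: X'_def)
  then have "card X \<le> card X' + card {a..<a+g}"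
    using Suc.prems by (intro order_trans[OF card_mono card_Un_le]) (auto simp: X'_def)
  then have "card X' > d * g" using Suc.prems by simp
  with Suc.IH[of X'] Suc.prems obtain Y where Y: "Y \<subseteq> X'" "card Y = Suc d"
    "\<forall>x\<in>Y. \<forall>y\<in>Y. x \<noteq> y \<longrightarrow> real g \<le> \<bar>real x - real y\<bar>"
    by (auto simp: X'_def)
  have far: "real g \<le> real y - real a" if "y \<in> Y" for y
  proof -
    from that Y(1) have "a + g \<le> y" by (auto simp: X'_def)
    then have "real (a + g) \<le> real y" by (rule of_nat_mono)
    then show ?thesis by simp
  qed
  have "a \<notin> Y" using far[of a] Suc.prems by auto
  moreover have "finite Y" using Y(2) by (metis card.infinite nat.distinct(1))
  ultimately have "card (insert a Y) = Suc (Suc d)" using Y by simp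
  moreover have "insert a Y \<subseteq> X" using Y aX by (auto simp: X'_def)
  moreover have "\<forall>x\<in>insert a Y. \<forall>y\<in>insert a Y. x \<noteq> y \<longrightarrow> real g \<le> \<bar>real x - real y\<bar>"
    using Y(3) far by (force simp: abs_if)
  ultimately show ?case by blast
qed

text \<open>Divided differences: splitting off a node \<open>y\<close> leaves the quotient
  \<open>P1\<close>, of one degree less and bounded by \<open>2 * \<beta> / \<eta>\<close> at the
  remaining nodes, to which the induction applies.\<close>

lemma coeff_bound_separated:
  fixes P :: "real poly"
  assumes "card Y = Suc d" "degree P \<le> d" "0 < \<eta>" "\<eta> \<le> 1"
    and "\<And>y. y \<in> Y \<Longrightarrow> \<bar>y\<bar> \<le> 1" "\<And>x y. x \<in> Y \<Longrightarrow> y \<in> Y \<Longrightarrow> x \<noteq> y \<Longrightarrow> \<eta> \<le> \<bar>x - y\<bar>"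
    and "\<And>y. y \<in> Y \<Longrightarrow> \<bar>poly P y\<bar> \<le> \<beta>"
  shows "\<bar>coeff P k\<bar> \<le> (6 / \<eta>) ^ d * \<beta>"
  using assms
proof (induction d arbitrary: P Y \<beta> k)
  case 0
  then obtain y where y: "Y = {y}" by (auto simp: card_Suc_eq)
  from 0 obtain c where c: "P = [:c:]" by (metis degree_eq_zeroE le_zero_eq)
  have "\<bar>c\<bar> \<le> \<beta>" using 0(7)[of y] y c by simp
  then show ?case using c by (cases k) auto
next
  case (Suc d)
  from Suc.prems(1) obtain y where "y \<in> Y" by fastforce
  moreover define Z where "Z = Y - {y}"
  ultimately have Z: "Y = insert y Z" "y \<notin> Z" "card Z = Suc d"
    using Suc.prems(1) by auto
  have fP: "0 \<le> \<beta>" using Suc.prems(7)[of y] Z by auto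
  define P1 where "P1 = synthetic_div P y"
  have P: "P = [:poly P y:] + [:- y, 1:] * P1"
    using synthetic_div_correct'[of y P] by (simp add: P1_def add.commute)
  have deg: "degree P1 \<le> d" using Suc.prems(2) by (simp add: P1_def degree_synthetic_div)
  have bd: "\<bar>poly P1 z\<bar> \<le> 2 * \<beta> / \<eta>" if "z \<in> Z" for z
  proof -
    have zy: "\<eta> \<le> \<bar>z - y\<bar>" using Suc.prems(6)[of z y] that Z by auto
    have "poly P z = poly P y + (z - y) * poly P1 z"
      using arg_cong[OF P, of "\<lambda>p. poly p z"] by (simp add: algebra_simps)
    then have "\<bar>z - y\<bar> * \<bar>poly P1 z\<bar> = \<bar>poly P z - poly P y\<bar>" by (simp add: abs_mult)
    also have "\<dots> \<le> 2 * \<beta>" using Suc.prems(7)[of z] Suc.prems(7)[of y] that Z by auto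
    finally have "\<eta> * \<bar>poly P1 z\<bar> \<le> 2 * \<beta>"
      using zy mult_right_mono[OF zy, of "\<bar>poly P1 z\<bar>"] by linarith
    then show ?thesis using Suc.prems(3) by (simp add: field_simps)
  qed
  define C where "C = (6 / \<eta>) ^ d * (2 * \<beta> / \<eta>)"
  have IH: "\<bar>coeff P1 j\<bar> \<le> C" for j
    unfolding C_def by (rule Suc.IH[of Z]) (use Suc.prems Z deg bd in auto)
  have y1: "\<bar>y\<bar> \<le> 1" using Suc.prems(5) Z by auto
  have yC: "\<bar>y * coeff P1 j\<bar> \<le> C" for j
    using mult_mono[OF y1 IH[of j]] by (simp add: abs_mult)
  have "\<bar>coeff P k\<bar> \<le> \<beta> + 2 * C"
  proof -
    have py: "\<bar>poly P y\<bar> \<le> \<beta>" using Suc.prems(7) Z by auto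
    have C0: "0 \<le> C" using IH[of 0] by linarith
    show ?thesis
    proof (cases k)
      case 0
      have "coeff P k = poly P y - y * coeff P1 0" using 0 arg_cong[OF P, of "\<lambda>p. coeff p k"] by simp
      then show ?thesis using py yC[of 0] C0 by linarith
    next
      case (Suc j)
      have "coeff P k = coeff P1 j - y * coeff P1 k" using Suc arg_cong[OF P, of "\<lambda>p. coeff p k"] by (simp add: coeff_pCons)
      then show ?thesis using IH[of j] yC[of k] fP by linarith
    qed
  qed
  \<comment> \<open>The 6 arises here: \<open>C = 2 * W\<close> and
    \<open>\<beta> \<le> 2 * W\<close>, so \<open>\<beta> + 2 * C \<le> 6 * W\<close>.\<close>
  also have "\<dots> \<le> (6 / \<eta>) ^ Suc d * \<beta>"
  proof -
    have "1 \<le> (6 / \<eta>) ^ d" using Suc.prems(3,4) by (intro one_le_power) (simp add: field_simps)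
    then have "\<eta> \<le> 2 * (6 / \<eta>) ^ d" using Suc.prems(4) by linarith
    then have "1 \<le> 2 * (6 / \<eta>) ^ d / \<eta>" using Suc.prems(3) by (simp add: field_simps)
    define W where "W = (6 / \<eta>) ^ d * \<beta> / \<eta>"
    from mult_right_mono[OF \<open>1 \<le> 2 * (6 / \<eta>) ^ d / \<eta>\<close> fP]
    have "\<beta> \<le> 2 * W" by (simp add: W_def mult_ac)
    moreover have "C = 2 * W" by (simp add: C_def W_def)
    moreover have "(6 / \<eta>) ^ Suc d * \<beta> = 6 * W" by (simp add: W_def)
    ultimately show ?thesis by linarith
  qed
  finally show ?case .
qed

text \<open>A set of proportion \<open>\<delta>\<close> contains \<open>d + 1\<close> points whose
  scaled distances are at least \<open>\<delta> / (2 * d)\<close> up to rounding. Rounding costs a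
  factor 2, and 6 divided by \<open>\<delta> / (4 * d)\<close> is the base of the power.\<close>

lemma coeff_bound_dense:
  fixes P :: "real poly"
  assumes "d \<ge> 1" "degree P \<le> d" "X \<subseteq> {1..n}" "real (card X) \<ge> \<delta> * real n" "\<delta> > 0"
    and "real n \<ge> 2 * real d / \<delta>"
    and "\<And>i. i \<in> X \<Longrightarrow> \<bar>poly P (real i / real n)\<bar> \<le> \<beta>"
  shows "\<bar>coeff P k\<bar> \<le> (24 * real d / \<delta>) ^ d * \<beta>"
proof -
  have fin: "finite X" using assms(3) by (rule finite_subset) simp
  have n0: "real n > 0" using assms(1,5,6) by (smt (verit) divide_pos_pos of_nat_1 of_nat_le_iff)
  define u where "u = \<delta> * real n / (2 * real d)"
  define g where "g = nat \<lfloor>u\<rfloor>"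
  have u1: "1 \<le> u" using assms(1,5,6) by (simp add: u_def field_simps)
  have g1: "g \<ge> 1" using u1 by (simp add: g_def le_nat_floor)
  have gu: "real g \<le> u" using u1 by (simp add: g_def)
  \<comment> \<open>Rounding down loses at most half because \<open>u \<ge> 1\<close>; the lower
    bound on \<open>n\<close> provides this.\<close>
  have gu2: "u / 2 \<le> real g" using u1 g1 unfolding g_def by linarith
  have dg: "real (d * g) \<le> \<delta> * real n / 2"
    using mult_left_mono[OF gu, of "real d"] assms(1) by (simp add: u_def)
  also have "\<dots> < \<delta> * real n" using assms(5) n0 by simp
  finally have card: "card X > d * g" using assms(4) by linarith
  obtain Y where Y: "Y \<subseteq> X" "card Y = Suc d"
    "\<forall>x\<in>Y. \<forall>y\<in>Y. x \<noteq> y \<longrightarrow> real g \<le> \<bar>real x - real y\<bar>"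
    using separated_subset[OF fin card] g1 by auto
  have "card X \<le> n" using card_mono[OF _ assms(3)] by simp
  then have "d * g \<le> n" using card by simp
  then have gn: "g \<le> n" using assms(1) by (metis dual_order.trans mult_le_mono1 mult_1)
  define h where "h = (\<lambda>i. real i / real n)"
  have inj: "inj_on h Y" using n0 by (auto simp: h_def inj_on_def)
  have "\<bar>coeff P k\<bar> \<le> (6 / (real g / real n)) ^ d * \<beta>"
  proof (rule coeff_bound_separated[where Y = "h ` Y"])
    show "card (h ` Y) = Suc d" using card_image[OF inj] Y by simp
    show "0 < real g / real n" "real g / real n \<le> 1" using g1 gn n0 by auto
    show "\<bar>y\<bar> \<le> 1" if "y \<in> h ` Y" for y
      using that Y(1) assms(3) n0 by (auto simp: h_def)
    show "real g / real n \<le> \<bar>x - y\<bar>" if "x \<in> h ` Y" "y \<in> h ` Y" "x \<noteq> y" for x y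
    proof -
      from that obtain i j where ij: "i \<in> Y" "j \<in> Y" "i \<noteq> j" "x = h i" "y = h j" by auto
      then have "x - y = (real i - real j) / real n" by (simp add: h_def diff_divide_distrib)
      then have "\<bar>x - y\<bar> = \<bar>real i - real j\<bar> / real n" using n0 by simp
      then show ?thesis using Y(3) ij n0 by (simp add: divide_right_mono)
    qed
    show "\<bar>poly P y\<bar> \<le> \<beta>" if "y \<in> h ` Y" for y using that Y(1) assms(7) by (auto simp: h_def)
  qed (use assms in auto)
  also have "\<dots> \<le> (24 * real d / \<delta>) ^ d * \<beta>"
  proof (intro mult_right_mono power_mono)
    have "\<delta> / (4 * real d) \<le> real g / real n"
      using gu2 n0 assms(1) by (simp add: u_def field_simps)
    moreover have "0 < (real g / real n) * (\<delta> / (4 * real d))"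
      using assms(1,5) g1 n0 by simp
    ultimately have "6 / (real g / real n) \<le> 6 / (\<delta> / (4 * real d))"
      by (intro divide_left_mono) simp_all
    then show "6 / (real g / real n) \<le> 24 * real d / \<delta>" by simp
    obtain y where "y \<in> Y" using Y(2) by fastforce
    then show "0 \<le> \<beta>" using assms(7)[of y] Y(1) by force
  qed auto
  finally show ?thesis .
qed

lemma poly_bound_unit:
  fixes P :: "real poly"
  assumes "\<bar>x\<bar> \<le> 1" "degree P \<le> d" "\<And>k. \<bar>coeff P k\<bar> \<le> C"
  shows "\<bar>poly P x\<bar> \<le> (real d + 1) * C"
proof -
  have C0: "0 \<le> C" using assms(3)[of 0] by linarith
  have "\<bar>poly P x\<bar> \<le> (\<Sum>i\<le>degree P. \<bar>coeff P i * x ^ i\<bar>)"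
    unfolding poly_altdef by (rule sum_abs)
  also have "\<dots> \<le> (\<Sum>i\<le>degree P. C)"
  proof (rule sum_mono)
    fix i
    have "\<bar>x ^ i\<bar> \<le> 1" using assms(1) by (simp add: power_abs power_le_one)
    with mult_mono[OF assms(3)[of i] this] C0 show "\<bar>coeff P i * x ^ i\<bar> \<le> C" by (simp add: abs_mult)
  qed
  also have "\<dots> = (real (degree P) + 1) * C" by simp
  also have "\<dots> \<le> (real d + 1) * C" using assms(2) C0 by (intro mult_right_mono) auto
  finally show ?thesis .
qed

lemma coeff_pderiv_bound:
  fixes P :: "real poly"
  assumes "degree P \<le> d" "\<And>k. \<bar>coeff P k\<bar> \<le> C"
  shows "\<bar>coeff (pderiv P) k\<bar> \<le> real d * C"
proof (cases "Suc k \<le> d")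
  case True
  have "real (Suc k) * \<bar>coeff P (Suc k)\<bar> \<le> real d * C"
    using True assms(2) by (intro mult_mono) auto
  then show ?thesis by (simp add: coeff_pderiv abs_mult)
next
  case False
  then have "coeff P (Suc k) = 0" using assms(1) by (intro coeff_eq_0) simp
  moreover have "0 \<le> C" using assms(2)[of 0] by linarith
  ultimately show ?thesis by (simp add: coeff_pderiv)
qed

section \<open>Grid points whose phase is close to a multiple of pi\<close>

lemma card_int_le_diameter:
  fixes X :: "int set"
  assumes "finite X" "D \<ge> 0" "\<And>x y. x \<in> X \<Longrightarrow> y \<in> X \<Longrightarrow> real_of_int (x - y) \<le> D"
  shows "real (card X) \<le> D + 1"
proof (cases "X = {}")
  case False
  have "X \<subseteq> {Min X..Max X}" using assms(1) by auto
  from card_mono[OF _ this] have "card X \<le> nat (Max X - Min X + 1)" by simp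
  moreover have "Min X \<le> Max X" using assms(1) False by simp
  ultimately have "real (card X) \<le> real_of_int (Max X - Min X + 1)" by linarith
  then show ?thesis using assms(3)[of "Max X" "Min X"] assms(1) False by simp
qed (use assms in simp)

lemma card_nat_le_diameter:
  fixes X :: "nat set"
  assumes "finite X" "D \<ge> 0" "\<And>x y. x \<in> X \<Longrightarrow> y \<in> X \<Longrightarrow> real x - real y \<le> D"
  shows "real (card X) \<le> D + 1"
proof -
  have "real (card (int ` X)) \<le> D + 1"
    using assms by (intro card_int_le_diameter) auto
  then show ?thesis by (simp add: card_image)
qed

text \<open>Attach each index to a multiple of pi near its phase. The total growth of
  \<open>f\<close> limits how many multiples occur; the slope of at least \<open>a\<close> limits
  how many indices share one.\<close>

lemma card_near_multiples:
  fixes f :: "nat \<Rightarrow> real"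
  assumes "finite X" "0 < a" "a \<le> b" "0 \<le> \<rho>" "0 \<le> l"
    and lo: "\<And>i j. i \<in> X \<Longrightarrow> j \<in> X \<Longrightarrow> i < j \<Longrightarrow> a * (real j - real i) \<le> f j - f i"
    and hi: "\<And>i j. i \<in> X \<Longrightarrow> j \<in> X \<Longrightarrow> i < j \<Longrightarrow> f j - f i \<le> b * (real j - real i)"
    and diam: "\<And>i j. i \<in> X \<Longrightarrow> j \<in> X \<Longrightarrow> real j - real i \<le> l"
    and near: "\<And>i. i \<in> X \<Longrightarrow> \<exists>k::int. \<bar>f i - of_int k * pi\<bar> \<le> \<rho>"
  shows "real (card X) \<le> (2 * \<rho> / a + 1) * ((b * l + 2 * \<rho>) / pi + 1)"
proof -
  from near obtain k :: "nat \<Rightarrow> int" where k: "\<And>i. i \<in> X \<Longrightarrow> \<bar>f i - of_int (k i) * pi\<bar> \<le> \<rho>" by metis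
  have diff: "f j - f i \<le> b * l" if "i \<in> X" "j \<in> X" for i j
  proof (cases i j rule: linorder_cases)
    case less
    have "b * (real j - real i) \<le> b * l" using diam that assms by (intro mult_left_mono) auto
    then show ?thesis using hi[OF that less] by linarith
  next
    case equal
    then show ?thesis using assms by simp
  next
    case greater
    have "0 \<le> a * (real i - real j)" using greater assms by simp
    moreover have "0 \<le> b * l" using assms by simp
    ultimately show ?thesis using lo[OF that(2,1) greater] by linarith
  qed
  have img: "real (card (k ` X)) \<le> (b * l + 2 * \<rho>) / pi + 1"
  proof (rule card_int_le_diameter)
    fix x y assume "x \<in> k ` X" "y \<in> k ` X"
    then obtain i j where ij: "i \<in> X" "j \<in> X" "x = k i" "y = k j" by auto
    have "real_of_int (x - y) * pi = of_int (k i) * pi - of_int (k j) * pi"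
      using ij by (simp add: algebra_simps)
    also have "\<dots> \<le> b * l + 2 * \<rho>"
      using k[OF ij(1)] k[OF ij(2)] diff[OF ij(2,1)] by linarith
    finally show "real_of_int (x - y) \<le> (b * l + 2 * \<rho>) / pi" by (simp add: field_simps)
  qed (use assms in auto)
  have fib: "real (card {i\<in>X. k i = c}) \<le> 2 * \<rho> / a + 1" for c
  proof (rule card_nat_le_diameter)
    fix j i assume "j \<in> {i\<in>X. k i = c}" "i \<in> {i\<in>X. k i = c}"
    then have ij: "i \<in> X" "j \<in> X" "k i = k j" by auto
    show "real j - real i \<le> 2 * \<rho> / a"
    proof (cases "i < j")
      case True
      have "a * (real j - real i) \<le> 2 * \<rho>"
        using lo[OF ij(1,2) True] k[OF ij(1), unfolded ij(3)] k[OF ij(2)] by linarith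
      then show ?thesis using assms by (simp add: field_simps)
    next
      case False
      moreover have "0 \<le> 2 * \<rho> / a" using assms by simp
      ultimately show ?thesis by linarith
    qed
  qed (use assms in auto)
  have "card X = card (\<Union>c\<in>k ` X. {i\<in>X. k i = c})" by (rule arg_cong[where f = card]) auto
  also have "\<dots> \<le> (\<Sum>c\<in>k ` X. card {i\<in>X. k i = c})"
    by (rule card_UN_le) (simp add: assms(1))
  finally have "real (card X) \<le> real (\<Sum>c\<in>k ` X. card {i\<in>X. k i = c})" by (rule of_nat_mono)
  also have "\<dots> = (\<Sum>c\<in>k ` X. real (card {i\<in>X. k i = c}))" by simp
  also have "\<dots> \<le> (\<Sum>c\<in>k ` X. 2 * \<rho> / a + 1)" by (intro sum_mono fib)
  also have "\<dots> = (2 * \<rho> / a + 1) * real (card (k ` X))" by simp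
  also have "\<dots> \<le> (2 * \<rho> / a + 1) * ((b * l + 2 * \<rho>) / pi + 1)"
    using img assms by (intro mult_left_mono) auto
  finally show ?thesis .
qed

text \<open>Up to \<open>pi / 3\<close> the derivative \<open>2 * cos u - 1\<close> is nonnegative;
  beyond, \<open>2 * sin y\<close> is at least \<open>sqrt 3 \<ge> 1.7\<close> while
  \<open>y \<le> 1.6\<close>.\<close>

lemma abs_le_2_abs_sin:
  fixes x :: real
  assumes "\<bar>x\<bar> \<le> pi / 2"
  shows "\<bar>x\<bar> \<le> 2 * \<bar>sin x\<bar>"
proof -
  have pos: "y \<le> 2 * sin y" if y: "0 \<le> y" "y \<le> pi / 2" for y :: real
  proof (cases "y \<le> pi / 3")
    case True
    have "2 * sin 0 - 0 \<le> 2 * sin y - y"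
    proof (rule DERIV_nonneg_imp_nondecreasing[OF y(1)])
      fix u :: real assume u: "0 \<le> u" "u \<le> y"
      have "cos (pi / 3) \<le> cos u" using u True by (intro cos_monotone_0_pi_le) auto
      then have "0 \<le> 2 * cos u - 1" by (simp add: cos_60)
      moreover have "((\<lambda>u. 2 * sin u - u) has_real_derivative (2 * cos u - 1)) (at u)"
        by (auto intro!: derivative_eq_intros)
      ultimately show "\<exists>z. ((\<lambda>u. 2 * sin u - u) has_real_derivative z) (at u) \<and> 0 \<le> z" by blast
    qed
    then show ?thesis by simp
  next
    case False
    have "sin (pi / 3) \<le> sin y" using False y by (intro sin_monotone_2pi_le) auto
    then have "sqrt 3 \<le> 2 * sin y" by (simp add: sin_60)
    moreover have "(1.7::real) \<le> sqrt 3" by (rule real_le_rsqrt) (simp add: power2_eq_square)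
    moreover have "y \<le> 1.6" using y pi_approx by simp
    ultimately show ?thesis by linarith
  qed
  show ?thesis using pos[of "\<bar>x\<bar>"] assms by (cases "x \<ge> 0") (auto simp: abs_if)
qed

lemma near_multiple_of_sin_small:
  fixes x :: real
  shows "\<exists>k::int. \<bar>x - of_int k * pi\<bar> \<le> 2 * \<bar>sin x\<bar>"
proof -
  define k where "k = round (x / pi)"
  have "\<bar>of_int k - x / pi\<bar> \<le> 1 / 2" unfolding k_def by (rule of_int_round_abs_le)
  then have "\<bar>of_int k - x / pi\<bar> * pi \<le> 1 / 2 * pi" by (intro mult_right_mono) auto
  also have "\<bar>of_int k - x / pi\<bar> * pi = \<bar>(of_int k - x / pi) * pi\<bar>" by (simp add: abs_mult)
  also have "(of_int k - x / pi) * pi = of_int k * pi - x" by (simp add: algebra_simps)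
  finally have le: "\<bar>x - of_int k * pi\<bar> \<le> pi / 2" by linarith
  have "\<bar>sin (x - of_int k * pi)\<bar> = \<bar>sin x\<bar>"
    by (simp add: sin_diff abs_mult mult.commute sin_int_times_real cos_int_times_real)
  then show ?thesis using abs_le_2_abs_sin[OF le] by metis
qed

text \<open>One steep point makes the whole block steep: its scaled length is at most
  \<open>2 / H\<close>, so \<open>pderiv Q\<close> varies by at most
  \<open>2 * M / H \<le> \<gamma>\<close> and stays at least \<open>\<gamma>\<close>. The phase then
  increases with slopes between \<open>s * \<gamma> / n\<close> and \<open>s * M / n\<close>, which
  is the situation of \<open>card_near_multiples\<close>.\<close>

lemma card_block_aux:
  fixes Q :: "real poly" and n :: nat and s \<theta> \<gamma> M H :: real
  assumes "X \<subseteq> {1..n}" "p \<in> X" "2 * \<gamma> \<le> poly (pderiv Q) (real p / real n)"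
    and M: "\<And>x. \<bar>x\<bar> \<le> 1 \<Longrightarrow> \<bar>poly (pderiv Q) x\<bar> \<le> M" "\<And>x. \<bar>x\<bar> \<le> 1 \<Longrightarrow> \<bar>poly (pderiv (pderiv Q)) x\<bar> \<le> M"
    and "0 < \<gamma>" "0 < H" "2 * M \<le> \<gamma> * H" "0 < s" "0 \<le> \<rho>"
    and diam: "\<And>i j. i \<in> X \<Longrightarrow> j \<in> X \<Longrightarrow> real j - real i \<le> 2 * real n / H"
    and near: "\<And>i. i \<in> X \<Longrightarrow> \<exists>k::int. \<bar>(s * poly Q (real i / real n) - \<theta>) - of_int k * pi\<bar> \<le> \<rho>"
  shows "real (card X) \<le> (2 * \<rho> / (s * \<gamma> / real n) + 1) * ((s * M / real n * (2 * real n / H) + 2 * \<rho>) / pi + 1)"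
proof -
  define h where "h i = real i / real n" for i :: nat
  have n0: "real n > 0" using assms(1,2) by (cases n) auto
  have hX: "0 \<le> h i" "h i \<le> 1" if "i \<in> X" for i using that assms(1) n0 by (auto simp: h_def)
  have der: "\<gamma> \<le> poly (pderiv Q) x" if x: "h i \<le> x" "x \<le> h j" and ij: "i \<in> X" "j \<in> X" for x i j
  proof -
    have x01: "0 \<le> x" "x \<le> 1" using hX[OF ij(1)] hX[OF ij(2)] x by linarith+
    have d1: "h k - h l \<le> 2 / H" if "k \<in> X" "l \<in> X" for k l
    proof -
      have "h k - h l = (real k - real l) / real n" by (simp add: h_def diff_divide_distrib)
      also have "\<dots> \<le> (2 * real n / H) / real n" using diam[OF that(2,1)] n0 by (intro divide_right_mono) auto
      finally show ?thesis using n0 by simp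
    qed
    have dx: "\<bar>x - h p\<bar> \<le> 2 / H" using d1[OF ij(2) assms(2)] d1[OF assms(2) ij(1)] x by linarith
    obtain z where z: "z \<in> {0..1}" "poly (pderiv Q) x - poly (pderiv Q) (h p) = (x - h p) * poly (pderiv (pderiv Q)) z"
      using poly_MVT'[of "h p" x "{0..1}" "pderiv Q"] hX[OF assms(2)] x01 by auto
    have "\<bar>(x - h p) * poly (pderiv (pderiv Q)) z\<bar> \<le> 2 / H * M"
      unfolding abs_mult using dx M(2)[of z] z(1) assms(7) by (intro mult_mono) auto
    also have "\<dots> \<le> \<gamma>" using assms(7,8) by (simp add: field_simps)
    finally have "\<bar>poly (pderiv Q) x - poly (pderiv Q) (h p)\<bar> \<le> \<gamma>" using z(2) by simp
    then show ?thesis using assms(3) by (simp add: h_def)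
  qed
  have mvt: "\<exists>D. \<gamma> \<le> D \<and> D \<le> M \<and> s * poly Q (h j) - s * poly Q (h i) = s * D / real n * (real j - real i)"
    if ij: "i \<in> X" "j \<in> X" "i < j" for i j
  proof -
    have "h i < h j" using ij n0 by (simp add: h_def divide_strict_right_mono)
    from poly_MVT[OF this, of Q] obtain x where x: "h i < x" "x < h j"
      "poly Q (h j) - poly Q (h i) = (h j - h i) * poly (pderiv Q) x" by blast
    have "\<gamma> \<le> poly (pderiv Q) x" using der[of i x j] x ij by simp
    moreover have "poly (pderiv Q) x \<le> M" using M(1)[of x] x hX[OF ij(1)] hX[OF ij(2)] by auto
    moreover have "s * poly Q (h j) - s * poly Q (h i) = s * (poly Q (h j) - poly Q (h i))"
      by (simp add: algebra_simps)
    moreover have "\<dots> = s * poly (pderiv Q) x / real n * (real j - real i)"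
      unfolding x(3) by (simp add: h_def diff_divide_distrib[symmetric])
    ultimately show ?thesis by metis
  qed
  have gM: "\<gamma> \<le> M" using der[of p "h p" p] M(1)[of "h p"] hX[OF assms(2)] assms(2) by auto
  show ?thesis
  proof (rule card_near_multiples[where f = "\<lambda>i. s * poly Q (h i) - \<theta>"])
    show "finite X" using assms(1) by (rule finite_subset) simp
    show "0 < s * \<gamma> / real n" "s * \<gamma> / real n \<le> s * M / real n" "0 \<le> \<rho>" "0 \<le> 2 * real n / H"
      using assms gM n0 by (auto intro!: divide_right_mono mult_left_mono)
    fix i j assume ij: "i \<in> X" "j \<in> X"
    show "real j - real i \<le> 2 * real n / H" using diam ij by simp
    assume "i < j"
    from mvt[OF ij this] obtain D where D: "\<gamma> \<le> D" "D \<le> M"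
      "s * poly Q (h j) - s * poly Q (h i) = s * D / real n * (real j - real i)" by blast
    have eq: "s * poly Q (h j) - \<theta> - (s * poly Q (h i) - \<theta>) = s * D / real n * (real j - real i)"
      using D(3) by simp
    show "s * \<gamma> / real n * (real j - real i) \<le> s * poly Q (h j) - \<theta> - (s * poly Q (h i) - \<theta>)"
      unfolding eq using D \<open>i < j\<close> assms n0 by (intro mult_right_mono divide_right_mono mult_left_mono) auto
    show "s * poly Q (h j) - \<theta> - (s * poly Q (h i) - \<theta>) \<le> s * M / real n * (real j - real i)"
      unfolding eq using D \<open>i < j\<close> assms n0 by (intro mult_right_mono divide_right_mono mult_left_mono) auto
  qed (use near in \<open>auto simp: h_def\<close>)
qed

text \<open>If the derivative at \<open>p\<close> is negative, \<open>- Q\<close> and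
  \<open>- \<theta>\<close> are used instead; this negates the phase and the nearby
  multiples.\<close>

lemma card_block:
  fixes Q :: "real poly" and n :: nat and s \<theta> \<gamma> M H :: real
  assumes "X \<subseteq> {1..n}" "p \<in> X" "2 * \<gamma> \<le> \<bar>poly (pderiv Q) (real p / real n)\<bar>"
    and M: "\<And>x. \<bar>x\<bar> \<le> 1 \<Longrightarrow> \<bar>poly (pderiv Q) x\<bar> \<le> M" "\<And>x. \<bar>x\<bar> \<le> 1 \<Longrightarrow> \<bar>poly (pderiv (pderiv Q)) x\<bar> \<le> M"
    and "0 < \<gamma>" "0 < H" "2 * M \<le> \<gamma> * H" "0 < s" "0 \<le> \<rho>"
    and diam: "\<And>i j. i \<in> X \<Longrightarrow> j \<in> X \<Longrightarrow> real j - real i \<le> 2 * real n / H"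
    and near: "\<And>i. i \<in> X \<Longrightarrow> \<exists>k::int. \<bar>(s * poly Q (real i / real n) - \<theta>) - of_int k * pi\<bar> \<le> \<rho>"
  shows "real (card X) \<le> (2 * \<rho> / (s * \<gamma> / real n) + 1) * ((s * M / real n * (2 * real n / H) + 2 * \<rho>) / pi + 1)"
proof (cases "2 * \<gamma> \<le> poly (pderiv Q) (real p / real n)")
  case True
  from card_block_aux[OF assms(1,2) True M assms(6-10) diam near] show ?thesis .
next
  case False
  show ?thesis
  proof (rule card_block_aux[where Q = "-Q" and \<theta> = "-\<theta>", OF assms(1,2) _ _ _ assms(6-10) diam])
    show "2 * \<gamma> \<le> poly (pderiv (- Q)) (real p / real n)"
      using False assms(3) by (simp add: pderiv_minus abs_if split: if_splits)
    show "\<bar>poly (pderiv (- Q)) x\<bar> \<le> M" if "\<bar>x\<bar> \<le> 1" for x using M(1)[OF that] by (simp add: pderiv_minus)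
    show "\<bar>poly (pderiv (pderiv (- Q))) x\<bar> \<le> M" if "\<bar>x\<bar> \<le> 1" for x using M(2)[OF that] by (simp add: pderiv_minus)
    show "\<exists>k::int. \<bar>s * poly (- Q) (real i / real n) - - \<theta> - of_int k * pi\<bar> \<le> \<rho>" if i: "i \<in> X" for i
    proof -
      from near[OF i] obtain k :: int where "\<bar>(s * poly Q (real i / real n) - \<theta>) - of_int k * pi\<bar> \<le> \<rho>" by blast
      then have "\<bar>s * poly (- Q) (real i / real n) - - \<theta> - of_int (- k) * pi\<bar> \<le> \<rho>" by simp
      then show ?thesis by blast
    qed
  qed
qed

text \<open>Indices with small derivative are few by \<open>flat\<close>; the others fall into
  \<open>H\<close> blocks with at most \<open>R\<close> of them in each. The threshold carries
  \<open>min 1 s\<close> so that its ratio to \<open>s\<close> is at most \<open>\<epsilon>\<close>: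
  the indices near one multiple then number about \<open>\<epsilon> * n\<close>, up to constants,
  uniformly in \<open>s\<close>. The bound on \<open>s * M\<close> keeps the number of multiples met
  below a small proportion of \<open>n\<close>.\<close>

lemma card_sin_small:
  fixes Q :: "real poly" and n :: nat and s \<theta> \<gamma> M :: real and H :: nat
  assumes M: "\<And>x. \<bar>x\<bar> \<le> 1 \<Longrightarrow> \<bar>poly (pderiv Q) x\<bar> \<le> M" "\<And>x. \<bar>x\<bar> \<le> 1 \<Longrightarrow> \<bar>poly (pderiv (pderiv Q)) x\<bar> \<le> M"
    and "0 < \<gamma>" "0 < H" "2 * M \<le> \<gamma> * real H" "0 < s" "1 \<le> n"
    and flat: "real (card {i\<in>{1..n}. \<bar>poly (pderiv Q) (real i / real n)\<bar> < 2 * \<gamma>}) \<le> \<delta> * real n / 8"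
    and cst: "0 < \<epsilon>" "\<epsilon> \<le> 1 / 4" "256 * \<epsilon> * M \<le> \<delta> * \<gamma>" "256 * \<epsilon> * real H \<le> \<delta> * \<gamma>"
      "64 * (s * M) \<le> \<delta> * real n" "64 * real H \<le> \<delta> * real n"
  shows "real (card {i\<in>{1..n}. \<bar>sin (s * poly Q (real i / real n) - \<theta>)\<bar> < \<epsilon> * min 1 s}) \<le> \<delta> * real n / 4"
proof -
  define Bad where "Bad = {i\<in>{1..n}. \<bar>sin (s * poly Q (real i / real n) - \<theta>)\<bar> < \<epsilon> * min 1 s}"
  define Flat where "Flat = {i\<in>{1..n}. \<bar>poly (pderiv Q) (real i / real n)\<bar> < 2 * \<gamma>}"
  define u where "u = min 1 s"
  define \<rho> where "\<rho> = 2 * \<epsilon> * u"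
  define R where "R = (2 * \<rho> / (s * \<gamma> / real n) + 1) * ((s * M / real n * (2 * real n / real H) + 2 * \<rho>) / pi + 1)"
  \<comment> \<open>Dividing by \<open>n + 1\<close> keeps \<open>i = n\<close> in a block with
    index below \<open>H\<close>; a block then has diameter below
    \<open>(n + 1) / H \<le> 2 * n / H\<close>.\<close>
  define blk where "blk j = {i\<in>Bad. i * H div (n + 1) = j}" for j
  have u: "0 < u" "u \<le> 1" "u \<le> s" using assms(6) by (auto simp: u_def)
  have n0: "real n > 0" using assms(7) by simp
  have M0: "0 \<le> M" using M(1)[of 0] by linarith
  have rho0: "0 \<le> \<rho>" using u cst by (simp add: \<rho>_def)
  have R0: "0 \<le> R" unfolding R_def using M0 rho0 u assms by (intro mult_nonneg_nonneg add_nonneg_nonneg divide_nonneg_nonneg) auto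
  have finB: "finite Bad" by (simp add: Bad_def)
  have blkle: "real (card (blk j - Flat)) \<le> R" for j
  proof (cases "blk j - Flat = {}")
    case True
    show ?thesis unfolding True using R0 by simp
  next
    case False
    then obtain i0 where i0: "i0 \<in> blk j - Flat" by blast
    show ?thesis unfolding R_def
    proof (rule card_block[where p = i0 and Q = Q and \<theta> = \<theta>])
      show "blk j - Flat \<subseteq> {1..n}" by (auto simp: blk_def Bad_def)
      show "2 * \<gamma> \<le> \<bar>poly (pderiv Q) (real i0 / real n)\<bar>"
        using i0 by (auto simp: blk_def Bad_def Flat_def)
      fix i k assume ik: "i \<in> blk j - Flat" "k \<in> blk j - Flat"
      have "k * H < (n + 1) * (j + 1)" "(n + 1) * j \<le> i * H"
      proof -
        have jk: "j = k * H div (n + 1)" "j = i * H div (n + 1)" using ik by (auto simp: blk_def)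
        show "k * H < (n + 1) * (j + 1)" using dividend_less_times_div[of "n+1" "k * H"] jk by simp
        show "(n + 1) * j \<le> i * H" using jk by (metis times_div_less_eq_dividend)
      qed
      then have "k * H < i * H + (n + 1)" by (simp add: algebra_simps)
      then have "real (k * H) < real (i * H + (n + 1))" by (rule less_imp_of_nat_less)
      then have "(real k - real i) * real H \<le> 2 * real n" using assms(7) by (simp add: algebra_simps)
      then show "real k - real i \<le> 2 * real n / real H" using assms(4) by (simp add: field_simps)
    next
      fix i assume "i \<in> blk j - Flat"
      then have "\<bar>sin (s * poly Q (real i / real n) - \<theta>)\<bar> < \<epsilon> * u" by (auto simp: blk_def Bad_def u_def)
      moreover obtain k :: int where "\<bar>(s * poly Q (real i / real n) - \<theta>) - of_int k * pi\<bar>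
          \<le> 2 * \<bar>sin (s * poly Q (real i / real n) - \<theta>)\<bar>"
        using near_multiple_of_sin_small by blast
      ultimately have "\<bar>(s * poly Q (real i / real n) - \<theta>) - of_int k * pi\<bar> \<le> 2 * (\<epsilon> * u)" by linarith
      then show "\<exists>k::int. \<bar>(s * poly Q (real i / real n) - \<theta>) - of_int k * pi\<bar> \<le> \<rho>"
        by (auto simp: \<rho>_def mult.assoc)
    qed (use assms M i0 rho0 in auto)
  qed
  have "Bad \<subseteq> Flat \<union> (\<Union>j<H. blk j - Flat)"
  proof
    fix i assume i: "i \<in> Bad"
    then have "i < n + 1" by (auto simp: Bad_def)
    then have "i * H < (n + 1) * H" using assms(4) by (rule mult_less_mono1)
    then have "i * H div (n + 1) < H" by (metis less_mult_imp_div_less mult.commute)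
    then show "i \<in> Flat \<union> (\<Union>j<H. blk j - Flat)" using i by (auto simp: blk_def)
  qed
  then have "card Bad \<le> card (Flat \<union> (\<Union>j<H. blk j - Flat))"
    by (intro card_mono) (auto simp: Flat_def blk_def finB)
  also have "\<dots> \<le> card Flat + card (\<Union>j<H. blk j - Flat)" by (rule card_Un_le)
  also have "\<dots> \<le> card Flat + (\<Sum>j<H. card (blk j - Flat))" by (intro add_left_mono card_UN_le) auto
  finally have "real (card Bad) \<le> real (card Flat + (\<Sum>j<H. card (blk j - Flat)))" by (rule of_nat_mono)
  also have "\<dots> = real (card Flat) + (\<Sum>j<H. real (card (blk j - Flat)))" by simp
  also have "\<dots> \<le> \<delta> * real n / 8 + (\<Sum>j<H. R)"
    using flat blkle by (intro add_mono sum_mono) (auto simp: Flat_def)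
  also have "(\<Sum>j<H. R) = real H * R" by simp
  also have "real H * R \<le> \<delta> * real n / 8"
  proof -
    \<comment> \<open>\<open>X + 1\<close> is the bound for the indices per multiple,
      \<open>Y\<close> the growth of the phase over a block. Expanding
      \<open>H * (X + 1) * (Y + 2)\<close> gives four terms, and each of the last four conditions of
      the lemma keeps one of them below \<open>\<delta> * n / 32\<close>.\<close>
    define X where "X = 4 * \<epsilon> * real n / \<gamma> * (u / s)"
    define Y where "Y = 2 * s * M / real H"
    have us: "u / s \<le> 1" using u by simp
    have e0: "4 * \<epsilon> * real n / \<gamma> \<ge> 0" using cst assms by simp
    have X: "0 \<le> X" unfolding X_def using e0 u by (intro mult_nonneg_nonneg) auto
    have X_le: "X \<le> 4 * \<epsilon> * real n / \<gamma>"
      using mult_left_mono[OF us e0] by (simp add: X_def)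
    have XY: "X * Y \<le> 8 * \<epsilon> * M * real n / (\<gamma> * real H)"
    proof -
      have "X * Y = u * (8 * \<epsilon> * M * real n / (\<gamma> * real H))" using u assms(6) by (simp add: X_def Y_def field_simps)
      also have "\<dots> \<le> 1 * (8 * \<epsilon> * M * real n / (\<gamma> * real H))"
        using u M0 cst assms by (intro mult_right_mono) auto
      finally show ?thesis by simp
    qed
    have Y0: "0 \<le> Y" using M0 assms by (simp add: Y_def)
    have w: "2 * \<rho> \<le> 1" using mult_mono[of \<epsilon> "1/4" u 1] u cst by (simp add: \<rho>_def)
    have Req: "R = (X + 1) * ((Y + 2 * \<rho>) / pi + 1)"
      using u assms n0 by (simp add: R_def X_def Y_def \<rho>_def field_simps)
    have "(Y + 2 * \<rho>) / pi \<le> (Y + 2 * \<rho>) / 1"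
      using Y0 rho0 pi_gt3 by (intro divide_left_mono) auto
    then have "R \<le> (X + 1) * (Y + 2)"
      unfolding Req using X w by (intro mult_left_mono) auto
    also have "\<dots> = X * Y + 2 * X + Y + 2" by (simp add: algebra_simps)
    also have "\<dots> \<le> 8 * \<epsilon> * M * real n / (\<gamma> * real H) + 2 * (4 * \<epsilon> * real n / \<gamma>) + Y + 2"
      using XY X_le by linarith
    finally have "real H * R \<le> real H * (8 * \<epsilon> * M * real n / (\<gamma> * real H) + 2 * (4 * \<epsilon> * real n / \<gamma>) + Y + 2)"
      by (intro mult_left_mono) auto
    also have "\<dots> = 8 * \<epsilon> * M * real n / \<gamma> + 8 * \<epsilon> * real H * real n / \<gamma> + 2 * (s * M) + 2 * real H"
      using assms(3,4) by (simp add: Y_def field_simps)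
    also have "\<dots> \<le> \<delta> * real n / 32 + \<delta> * real n / 32 + \<delta> * real n / 32 + \<delta> * real n / 32"
    proof (intro add_mono)
      show "8 * \<epsilon> * M * real n / \<gamma> \<le> \<delta> * real n / 32"
        using mult_right_mono[OF cst(3), of "real n"] assms(3) by (simp add: field_simps)
      show "8 * \<epsilon> * real H * real n / \<gamma> \<le> \<delta> * real n / 32"
        using mult_right_mono[OF cst(4), of "real n"] assms(3) by (simp add: field_simps)
    qed (use cst in auto)
    finally show ?thesis by simp
  qed
  finally show ?thesis by (simp add: Bad_def)
qed

text \<open>\<open>coeff_bound_dense\<close> is used in two directions. Boundedness on
  \<open>I\<close> bounds the coefficients, hence both derivatives, by constants free of
  \<open>n\<close>. Conversely, if \<open>pderiv Q\<close> were below \<open>2 * \<gamma>\<close> on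
  a proportion \<open>\<delta> / 8\<close> of the grid, its top coefficient \<open>d * b\<close>
  would be too small. Uniformity in \<open>\<theta>\<close> matters because \<open>\<theta>\<close>
  will be the phase of the partner index.\<close>

lemma poly_values_spread:
  fixes d :: nat and \<delta> b B :: real
  assumes "d \<ge> 2" "\<delta> > 0" "b \<noteq> 0" "B > 0"
  shows "\<exists>\<epsilon>>0. \<epsilon> \<le> 1 \<and> (\<exists>\<sigma>>0. \<exists>N. \<forall>n\<ge>N. \<forall>I v s \<theta>. I \<subseteq> {1..n} \<longrightarrow> real (card I) \<ge> \<delta> * real n \<longrightarrow>
     poly_on d b B n I v \<longrightarrow> \<bar>s\<bar> \<le> \<sigma> * real n \<longrightarrow>
     real (card {i\<in>I. \<bar>sin (s * v i - \<theta>)\<bar> < \<epsilon> * min 1 \<bar>s\<bar>}) \<le> \<delta> * real n / 4)"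
proof -
  define C where "C = (24 * real d / \<delta>) ^ d * B"
  define M where "M = (real d + 1) * (real d * (real d * C))"
  have C: "0 < C" using assms by (simp add: C_def)
  have M0: "0 < M" using assms C by (simp add: M_def)
  \<comment> \<open>Makes the coefficient bound for \<open>pderiv Q\<close>, at proportion
    \<open>\<delta> / 8\<close> and size \<open>2 * \<gamma>\<close>, equal to
    \<open>d * |b| / 2\<close>, which contradicts the coefficient \<open>d * b\<close>.\<close>
  define \<gamma> where "\<gamma> = real d * \<bar>b\<bar> / (4 * (24 * real (d - 1) / (\<delta> / 8)) ^ (d - 1))"
  have F: "0 < (24 * real (d - 1) / (\<delta> / 8)) ^ (d - 1)" using assms by simp
  have g0: "0 < \<gamma>" unfolding \<gamma>_def using assms F by (intro divide_pos_pos mult_pos_pos) auto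
  define H where "H = nat \<lceil>2 * M / \<gamma>\<rceil> + 1"
  have H: "0 < H" "2 * M \<le> \<gamma> * real H"
  proof -
    have "2 * M / \<gamma> \<le> real H" by (simp add: H_def) linarith
    then show "2 * M \<le> \<gamma> * real H" using g0 by (simp add: field_simps)
  qed (simp add: H_def)
  define \<epsilon> where "\<epsilon> = min (1/4) (min (\<delta> * \<gamma> / (256 * M)) (\<delta> * \<gamma> / (256 * real H)))"
  have e: "0 < \<epsilon>" "\<epsilon> \<le> 1/4" "256 * \<epsilon> * M \<le> \<delta> * \<gamma>" "256 * \<epsilon> * real H \<le> \<delta> * \<gamma>"
  proof -
    show "0 < \<epsilon>" "\<epsilon> \<le> 1/4" using assms g0 M0 H by (auto simp: \<epsilon>_def)
    have "\<epsilon> \<le> \<delta> * \<gamma> / (256 * M)" by (simp add: \<epsilon>_def)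
    then show "256 * \<epsilon> * M \<le> \<delta> * \<gamma>" using M0 by (simp add: field_simps)
    have "\<epsilon> \<le> \<delta> * \<gamma> / (256 * real H)" by (simp add: \<epsilon>_def)
    then show "256 * \<epsilon> * real H \<le> \<delta> * \<gamma>" using H by (simp add: field_simps)
  qed
  define \<sigma> where "\<sigma> = \<delta> / (64 * M)"
  have s0: "\<sigma> > 0" using assms M0 by (simp add: \<sigma>_def)
  \<comment> \<open>The first bound is the block condition of \<open>card_sin_small\<close>; the
    other two are the size conditions of \<open>coeff_bound_dense\<close> for \<open>Q\<close> and
    for \<open>pderiv Q\<close>.\<close>
  define N where "N = nat \<lceil>max (64 * real H / \<delta>) (max (2 * real d / \<delta>) (2 * real (d - 1) / (\<delta> / 8)))\<rceil> + 1"
  have e1: "\<epsilon> \<le> 1" using e(2) by simp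
  show ?thesis
  proof (rule exI[of _ \<epsilon>], rule conjI[OF e(1)], rule conjI[OF e1], rule exI[of _ \<sigma>], rule conjI[OF s0], rule exI[of _ N], intro allI impI)
    fix n I v s \<theta>
    assume n: "N \<le> n" and I: "I \<subseteq> {1..n}" "real (card I) \<ge> \<delta> * real n"
      and po: "poly_on d b B n I v" and s: "\<bar>s\<bar> \<le> \<sigma> * real n"
    have "max (64 * real H / \<delta>) (max (2 * real d / \<delta>) (2 * real (d - 1) / (\<delta> / 8))) \<le> real N"
      unfolding N_def by linarith
    also have "real N \<le> real n" using n by simp
    finally have nn: "64 * real H / \<delta> \<le> real n" "2 * real d / \<delta> \<le> real n" "2 * real (d - 1) / (\<delta> / 8) \<le> real n"
      by auto
    have n1: "1 \<le> n" using n by (simp add: N_def)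
    have n0: "real n > 0" using n1 by simp
    from po obtain P where P: "degree P = d" "lead_coeff P = b" "\<And>i. i \<in> I \<Longrightarrow> v i = poly P (real i) / real n ^ d"
      and vB: "\<And>i. i \<in> I \<Longrightarrow> \<bar>v i\<bar> \<le> B" by (auto simp: poly_on_def)
    \<comment> \<open>The power of \<open>n\<close> produced by the substitution cancels the
      scaling, so \<open>Q\<close> keeps the leading coefficient \<open>b\<close> for every
      \<open>n\<close>.\<close>
    define Q where "Q = smult (1 / real n ^ d) (pcompose P [:0, real n:])"
    have dQ: "degree Q = d" using n0 P by (simp add: Q_def degree_pcompose)
    have lQ: "coeff Q d = b"
    proof -
      have "lead_coeff (pcompose P [:0, real n:]) = lead_coeff P * real n ^ degree P"
        using lead_coeff_comp[of "[:0, real n:]" P] n0 by simp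
      then have "coeff (pcompose P [:0, real n:]) d = b * real n ^ d"
        using P n0 by (simp add: degree_pcompose)
      then show ?thesis using n0 by (simp add: Q_def)
    qed
    have vQ: "v i = poly Q (real i / real n)" if "i \<in> I" for i
      using P(3)[OF that] n0 by (simp add: Q_def poly_pcompose)
    have cQ: "\<bar>coeff Q k\<bar> \<le> C" for k unfolding C_def
    proof (rule coeff_bound_dense[OF _ _ I assms(2) nn(2)])
      show "\<bar>poly Q (real i / real n)\<bar> \<le> B" if "i \<in> I" for i using vB[OF that] vQ[OF that] by simp
    qed (use assms dQ in auto)
    have cQ1: "\<bar>coeff (pderiv Q) k\<bar> \<le> real d * C" for k
      by (rule coeff_pderiv_bound[OF _ cQ]) (simp add: dQ)
    have cQ2: "\<bar>coeff (pderiv (pderiv Q)) k\<bar> \<le> real d * (real d * C)" for k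
      by (rule coeff_pderiv_bound[OF _ cQ1]) (simp add: dQ degree_pderiv)
    have M2: "\<bar>poly (pderiv (pderiv Q)) x\<bar> \<le> M" if "\<bar>x\<bar> \<le> 1" for x
      unfolding M_def by (rule poly_bound_unit[OF that _ cQ2]) (simp add: dQ degree_pderiv)
    have M1: "\<bar>poly (pderiv Q) x\<bar> \<le> M" if "\<bar>x\<bar> \<le> 1" for x
    proof -
      have "\<bar>poly (pderiv Q) x\<bar> \<le> (real d + 1) * (real d * C)"
        by (rule poly_bound_unit[OF that _ cQ1]) (simp add: dQ degree_pderiv)
      also have "\<dots> \<le> M" unfolding M_def using assms C by (intro mult_left_mono) auto
      finally show ?thesis .
    qed
    have flat: "real (card {i\<in>{1..n}. \<bar>poly (pderiv Q) (real i / real n)\<bar> < 2 * \<gamma>}) \<le> \<delta> * real n / 8"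
    proof (rule ccontr)
      assume neg: "\<not> ?thesis"
      have "\<bar>coeff (pderiv Q) (d - 1)\<bar> \<le> (24 * real (d - 1) / (\<delta> / 8)) ^ (d - 1) * (2 * \<gamma>)"
      proof (rule coeff_bound_dense[where X = "{i\<in>{1..n}. \<bar>poly (pderiv Q) (real i / real n)\<bar> < 2 * \<gamma>}", OF _ _ _ _ _ nn(3)])
        show "degree (pderiv Q) \<le> d - 1" by (simp add: degree_pderiv dQ)
      qed (use assms neg in auto)
      also have "\<dots> = real d * \<bar>b\<bar> / 2" unfolding \<gamma>_def using F assms by (simp add: field_simps)
      also have "coeff (pderiv Q) (d - 1) = real d * b" using assms(1) by (simp add: coeff_pderiv lQ of_nat_diff)
      finally show False using assms by (simp add: abs_mult)
    qed
    show "real (card {i\<in>I. \<bar>sin (s * v i - \<theta>)\<bar> < \<epsilon> * min 1 \<bar>s\<bar>}) \<le> \<delta> * real n / 4"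
    proof (cases "s = 0")
      case True
      then show ?thesis using assms by simp
    next
      case False
      \<comment> \<open>\<open>card_sin_small\<close> wants a positive frequency; a sign change of
        \<open>s\<close> is absorbed by one of \<open>\<theta>\<close>.\<close>
      define \<theta>' where "\<theta>' = (if s > 0 then \<theta> else - \<theta>)"
      have "\<bar>sin (\<bar>s\<bar> * x - \<theta>')\<bar> = \<bar>sin (s * x - \<theta>)\<bar>" for x
      proof (cases "s > 0")
        case neg: False
        then have "\<bar>s\<bar> * x - \<theta>' = - (s * x - \<theta>)" by (simp add: \<theta>'_def)
        then show ?thesis by (metis abs_minus_cancel sin_minus)
      qed (simp add: \<theta>'_def)
      then have "{i\<in>I. \<bar>sin (s * v i - \<theta>)\<bar> < \<epsilon> * min 1 \<bar>s\<bar>}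
        \<subseteq> {i\<in>{1..n}. \<bar>sin (\<bar>s\<bar> * poly Q (real i / real n) - \<theta>')\<bar> < \<epsilon> * min 1 \<bar>s\<bar>}"
        using I(1) vQ by auto
      then have "real (card {i\<in>I. \<bar>sin (s * v i - \<theta>)\<bar> < \<epsilon> * min 1 \<bar>s\<bar>})
        \<le> real (card {i\<in>{1..n}. \<bar>sin (\<bar>s\<bar> * poly Q (real i / real n) - \<theta>')\<bar> < \<epsilon> * min 1 \<bar>s\<bar>})"
        by (intro of_nat_mono card_mono) auto
      also have "\<dots> \<le> \<delta> * real n / 4"
      proof (rule card_sin_small[OF M1 M2 g0 H _ n1 flat e])
        show "64 * (\<bar>s\<bar> * M) \<le> \<delta> * real n"
          using mult_right_mono[OF s, of "64 * M"] M0 by (simp add: \<sigma>_def field_simps)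
        show "64 * real H \<le> \<delta> * real n" using nn(1) assms by (simp add: field_simps)
      qed (use False in auto)
      finally show ?thesis .
    qed
  qed
qed

section \<open>Exponential sums over permutations\<close>

text \<open>Half the drop of \<open>perm_sum\<close> when the images of pair \<open>k\<close> are
  swapped. Writing \<open>D\<close> for it, averaging over the swap multiplies the exponential by
  \<open>(1 + exp (- 2 * z * D)) / 2\<close>, of modulus \<open>|cos (t * D)|\<close> when
  \<open>z\<close> is purely imaginary with imaginary part \<open>t\<close>.\<close>

definition swap_gain :: "(nat \<Rightarrow> real) \<Rightarrow> (nat \<Rightarrow> real) \<Rightarrow> (nat \<Rightarrow> nat) \<Rightarrow> nat \<Rightarrow> (nat \<Rightarrow> nat) \<Rightarrow> real" where
  "swap_gain w v p k \<pi> = (w (p (2*k)) - w (p (2*k+1))) / 2 * (v (\<pi> (p (2*k))) - v (\<pi> (p (2*k+1))))"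

text \<open>Each pair is averaged over its own swap; as the pairs are disjoint, this leaves the
  factors of the others alone. The weight \<open>U\<close> and the general field allow two uses:
  complex \<open>z\<close> creates the factors, real \<open>z\<close> with an oscillation weight
  removes them again.\<close>

lemma symmetrized_exp_sum:
  fixes z :: "'a::{real_normed_field,banach}" and U :: "(nat \<Rightarrow> nat) \<Rightarrow> 'a"
  assumes p: "inj_on p {..<2*m}" "p ` {..<2*m} \<subseteq> {1..n}"
    and U: "\<And>\<pi> k. \<pi> \<in> Perms n \<Longrightarrow> k < m \<Longrightarrow> U (\<pi> \<circ> Transposition.transpose (p (2*k)) (p (2*k+1))) = U \<pi>"
  shows "(\<Sum>\<pi>\<in>Perms n. U \<pi> * exp (z * of_real (perm_sum n w v \<pi>))) =
    (\<Sum>\<pi>\<in>Perms n. U \<pi> * exp (z * of_real (perm_sum n w v \<pi>)) *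
      (\<Prod>k<m. (1 + exp (- 2 * z * of_real (swap_gain w v p k \<pi>))) / 2))"
proof -
  define E where "E \<pi> = exp (z * of_real (perm_sum n w v \<pi>))" for \<pi>
  define q where "q k \<pi> = (1 + exp (- 2 * z * of_real (swap_gain w v p k \<pi>))) / 2" for k \<pi>
  define \<tau> where "\<tau> k = Transposition.transpose (p (2*k)) (p (2*k+1))" for k
  have pin: "p i \<in> {1..n}" if "i < 2 * m" for i using p(2) that by blast
  have \<tau>: "\<tau> k permutes {1..n}" if "k < m" for k
    unfolding \<tau>_def using pin that by (intro permutes_swap_id) auto
  have E: "E (\<pi> \<circ> \<tau> k) = E \<pi> * exp (- 2 * z * of_real (swap_gain w v p k \<pi>))" if "k < m" for k \<pi>
  proof -
    have eq: "perm_sum n w v (\<pi> \<circ> \<tau> k) = perm_sum n w v \<pi> - 2 * swap_gain w v p k \<pi>"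
      unfolding \<tau>_def using pin that by (subst perm_sum_transpose) (auto simp: swap_gain_def)
    show ?thesis unfolding E_def eq exp_add[symmetric] by (simp add: algebra_simps)
  qed
  have fixp: "\<tau> k (p i) = p i" if "i \<noteq> 2*k" "i \<noteq> 2*k+1" "i < 2*m" "k < m" for i k
    unfolding \<tau>_def using that inj_onD[OF p(1), of i "2*k"] inj_onD[OF p(1), of i "2*k+1"]
    by (intro transpose_apply_other) auto
  have q: "q k (\<pi> \<circ> \<tau> j) = q k \<pi>" if "k \<noteq> j" "k < m" "j < m" for k j \<pi>
  proof -
    have "\<tau> j (p (2*k)) = p (2*k)" "\<tau> j (p (2*k+1)) = p (2*k+1)"
      using that by (intro fixp; presburger)+
    then show ?thesis by (simp add: q_def swap_gain_def)
  qed
  have "(\<Sum>\<pi>\<in>Perms n. U \<pi> * E \<pi>) = (\<Sum>\<pi>\<in>Perms n. U \<pi> * E \<pi> * (\<Prod>k<j. q k \<pi>))" if "j \<le> m" for j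
    using that
  proof (induction j)
    case (Suc j)
    define W where "W \<pi> = U \<pi> * (\<Prod>k<j. q k \<pi>)" for \<pi>
    have W: "W (\<pi> \<circ> \<tau> j) = W \<pi>" if "\<pi> \<in> Perms n" for \<pi>
    proof -
      have "(\<Prod>k<j. q k (\<pi> \<circ> \<tau> j)) = (\<Prod>k<j. q k \<pi>)"
        using Suc.prems by (intro prod.cong refl q) auto
      then show ?thesis using U[OF that, of j] Suc.prems by (simp add: W_def \<tau>_def)
    qed
    define X where "X = (\<Sum>\<pi>\<in>Perms n. W \<pi> * E \<pi>)"
    have "X = (\<Sum>\<pi>\<in>Perms n. W (\<pi> \<circ> \<tau> j) * E (\<pi> \<circ> \<tau> j))"
      unfolding X_def using Suc.prems by (intro sum_Perms_comp[symmetric] \<tau>) auto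
    also have "\<dots> = (\<Sum>\<pi>\<in>Perms n. W \<pi> * (E \<pi> * exp (- 2 * z * of_real (swap_gain w v p j \<pi>))))"
      using Suc.prems by (intro sum.cong refl) (simp add: W E)
    \<comment> \<open>Adding the sum reindexed by the swap to the original one produces
      \<open>2 * q j\<close>.\<close>
    finally have "X + X = (\<Sum>\<pi>\<in>Perms n. W \<pi> * E \<pi>) + \<dots>" by (simp add: X_def)
    also have "\<dots> = (\<Sum>\<pi>\<in>Perms n. 2 * (W \<pi> * E \<pi> * q j \<pi>))"
      unfolding sum.distrib[symmetric] by (intro sum.cong refl) (simp add: q_def algebra_simps)
    also have "\<dots> = 2 * (\<Sum>\<pi>\<in>Perms n. W \<pi> * E \<pi> * q j \<pi>)" by (simp add: sum_distrib_left)
    finally have "X = (\<Sum>\<pi>\<in>Perms n. W \<pi> * E \<pi> * q j \<pi>)" by (simp add: mult_2[symmetric])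
    then show ?case using Suc by (simp add: X_def W_def mult_ac)
  qed simp
  from this[of m] show ?thesis by (simp add: E_def q_def)
qed

text \<open>With \<open>E = exp (- 2 * a * x)\<close> and \<open>y = t * x\<close>, the squared
  modulus of the numerator is \<open>(1 + E)^2 - 4 * E * (sin y)^2\<close>. The hypothesis keeps
  \<open>E\<close> between \<open>exp (- 2)\<close> and \<open>exp 2\<close>, where
  \<open>4 * E / (1 + E)^2 \<ge> exp (- 2)\<close>, so oscillation still gains over the real factor
  \<open>(1 + E) / 2\<close>.\<close>

lemma norm_one_plus_exp_le:
  fixes a x t :: real
  assumes "\<bar>a * x\<bar> \<le> 1"
  shows "norm ((1 + exp (- 2 * Complex a t * of_real x)) / 2)
    \<le> (1 + exp (- 2 * a * x)) / 2 * sqrt (1 - exp (- 2) * (sin (t * x))\<^sup>2)"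
proof -
  define E where "E = exp (- 2 * a * x)"
  define y where "y = t * x"
  have z: "- 2 * Complex a t * of_real x = Complex (- 2 * a * x) (- 2 * y)"
    by (simp add: complex_eq_iff y_def)
  have sq: "(1 + E * c)\<^sup>2 + (E * s)\<^sup>2 = 1 + 2 * E * c + E\<^sup>2 * (s\<^sup>2 + c\<^sup>2)" for c s
    by (simp add: power2_eq_square algebra_simps)
  have "(norm (1 + exp (- 2 * Complex a t * of_real x)))\<^sup>2 = (1 + E * cos (2 * y))\<^sup>2 + (E * sin (2 * y))\<^sup>2"
    unfolding z by (simp add: cmod_power2 E_def Re_exp Im_exp)
  also have "\<dots> = 1 + 2 * E * cos (2 * y) + E\<^sup>2 * ((sin (2 * y))\<^sup>2 + (cos (2 * y))\<^sup>2)"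
    using sq by blast
  also have "\<dots> = (1 + E)\<^sup>2 - 4 * E * (sin y)\<^sup>2"
    unfolding sin_cos_squared_add unfolding cos_double_sin by (simp add: power2_eq_square algebra_simps)
  also have "\<dots> \<le> (1 + E)\<^sup>2 * (1 - exp (- 2) * (sin y)\<^sup>2)"
  proof -
    have E0: "0 < E" by (simp add: E_def)
    have lo: "exp (- 2) \<le> E" "exp (-2) * E \<le> 1"
      using assms by (auto simp: E_def exp_add[symmetric])
    have "exp (- 2) * (1 + E)\<^sup>2 \<le> 4 * E"
    proof (cases "E \<le> 1")
      case True
      have "(1 + E)\<^sup>2 \<le> 2\<^sup>2" using True E0 by (intro power_mono) auto
      then have "exp (- 2) * (1 + E)\<^sup>2 \<le> E * 4" using lo E0 by (intro mult_mono) auto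
      then show ?thesis by simp
    next
      case False
      have "(1 + E)\<^sup>2 \<le> (2 * E)\<^sup>2" using False by (intro power_mono) auto
      then have "exp (- 2) * (1 + E)\<^sup>2 \<le> exp (- 2) * (2 * E)\<^sup>2" by (intro mult_left_mono) auto
      also have "\<dots> = 4 * E * (exp (- 2) * E)" by (simp add: power2_eq_square)
      also have "\<dots> \<le> 4 * E * 1" using lo E0 by (intro mult_left_mono) auto
      finally show ?thesis by simp
    qed
    from mult_right_mono[OF this, of "(sin y)\<^sup>2"] show ?thesis by (simp add: algebra_simps)
  qed
  finally have "norm (1 + exp (- 2 * Complex a t * of_real x)) \<le> sqrt ((1 + E)\<^sup>2 * (1 - exp (- 2) * (sin y)\<^sup>2))"
    by (rule real_le_rsqrt)
  also have "\<dots> = (1 + E) * sqrt (1 - exp (- 2) * (sin y)\<^sup>2)"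
    by (simp add: real_sqrt_mult E_def add_nonneg_nonneg)
  finally show ?thesis by (simp add: norm_divide E_def y_def)
qed

text \<open>Termwise norms leave real factors and oscillation factors \<open>g\<close>. The product
  \<open>U\<close> of the latter is swap-invariant, since a swap only flips the sign of its own
  \<open>D k\<close>. Hence the real factors can be desymmetrised away, and Cauchy-Schwarz puts the
  square of \<open>U\<close> under the uniform law; squaring also removes the root in
  \<open>g\<close>.\<close>

lemma norm_tilted_exp_sum_le:
  fixes a t :: real
  assumes p: "inj_on p {..<2*m}" "p ` {..<2*m} \<subseteq> {1..n}"
    and small: "\<And>\<pi> k. \<pi> \<in> Perms n \<Longrightarrow> k < m \<Longrightarrow> \<bar>a * swap_gain w v p k \<pi>\<bar> \<le> 1"
  shows "norm (\<Sum>\<pi>\<in>Perms n. exp (Complex a t * of_real (perm_sum n w v \<pi>)))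
    \<le> sqrt (\<Sum>\<pi>\<in>Perms n. exp (2 * a * perm_sum n w v \<pi>)) *
      sqrt (\<Sum>\<pi>\<in>Perms n. \<Prod>k<m. 1 - exp (- 2) * (sin (t * swap_gain w v p k \<pi>))\<^sup>2)"
proof -
  define S where "S = perm_sum n w v"
  define D where "D = swap_gain w v p"
  define g where "g k \<pi> = sqrt (1 - exp (- 2) * (sin (t * D k \<pi>))\<^sup>2)" for k \<pi>
  define U where "U \<pi> = (\<Prod>k<m. g k \<pi>)" for \<pi>
  have arg: "exp (- 2) * (sin (t * D k \<pi>))\<^sup>2 \<le> 1" for k \<pi>
    using mult_mono[of "exp (- 2 :: real)" 1 "(sin (t * D k \<pi>))\<^sup>2" 1] by (simp add: abs_square_le_1)
  have Uinv: "U (\<pi> \<circ> Transposition.transpose (p (2*j)) (p (2*j+1))) = U \<pi>" if "j < m" for \<pi> j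
    unfolding U_def
  proof (intro prod.cong refl)
    fix k assume "k \<in> {..<m}"
    then have k: "k < m" by simp
    let ?\<tau> = "Transposition.transpose (p (2*j)) (p (2*j+1))"
    show "g k (\<pi> \<circ> ?\<tau>) = g k \<pi>"
    proof (cases "k = j")
      case True
      have "D k (\<pi> \<circ> ?\<tau>) = - D k \<pi>" using True 
        by (simp add: D_def swap_gain_def minus_mult_right del: mult_minus_right)
      then show ?thesis by (simp add: g_def)
    next
      case False
      have "?\<tau> (p i) = p i" if "i = 2*k \<or> i = 2*k+1" for i
      proof (rule transpose_apply_other)
        have i: "i \<in> {..<2*m}" "i \<noteq> 2*j" "i \<noteq> 2*j+1" using that k False by (auto; presburger)+
        have j: "2*j \<in> {..<2*m}" "2*j+1 \<in> {..<2*m}" using \<open>j < m\<close> by auto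
        show "p i \<noteq> p (2*j)" "p i \<noteq> p (2*j+1)"
          using inj_onD[OF p(1) _ i(1) j(1)] inj_onD[OF p(1) _ i(1) j(2)] i by blast+
      qed
      then show ?thesis by (simp add: g_def D_def swap_gain_def)
    qed
  qed
  have "norm (\<Sum>\<pi>\<in>Perms n. exp (Complex a t * of_real (S \<pi>)))
    = norm (\<Sum>\<pi>\<in>Perms n. exp (Complex a t * of_real (S \<pi>)) * (\<Prod>k<m. (1 + exp (- 2 * Complex a t * of_real (D k \<pi>))) / 2))"
    using symmetrized_exp_sum[OF p, where U = "\<lambda>_. 1" and z = "Complex a t" and w = w and v = v]
    by (simp add: S_def D_def)
  also have "\<dots> \<le> (\<Sum>\<pi>\<in>Perms n. norm (exp (Complex a t * of_real (S \<pi>)) * (\<Prod>k<m. (1 + exp (- 2 * Complex a t * of_real (D k \<pi>))) / 2)))"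
    by (rule norm_sum)
  also have "\<dots> \<le> (\<Sum>\<pi>\<in>Perms n. U \<pi> * exp (a * of_real (S \<pi>)) * (\<Prod>k<m. (1 + exp (- 2 * a * of_real (D k \<pi>))) / 2))"
  proof (rule sum_mono)
    fix \<pi> assume \<pi>: "\<pi> \<in> Perms n"
    have "norm (\<Prod>k<m. (1 + exp (- 2 * Complex a t * of_real (D k \<pi>))) / 2)
      = (\<Prod>k<m. norm ((1 + exp (- 2 * Complex a t * of_real (D k \<pi>))) / 2))" by (rule prod_norm[symmetric])
    also have "\<dots> \<le> (\<Prod>k<m. (1 + exp (- 2 * a * D k \<pi>)) / 2 * g k \<pi>)"
      unfolding g_def using small[OF \<pi>] by (intro prod_mono conjI norm_ge_zero norm_one_plus_exp_le) (auto simp: D_def)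
    also have "\<dots> = U \<pi> * (\<Prod>k<m. (1 + exp (- 2 * a * D k \<pi>)) / 2)"
      unfolding prod.distrib U_def by (rule mult.commute)
    finally have le: "norm (\<Prod>k<m. (1 + exp (- 2 * Complex a t * of_real (D k \<pi>))) / 2)
      \<le> U \<pi> * (\<Prod>k<m. (1 + exp (- 2 * a * D k \<pi>)) / 2)" .
    have "norm (exp (Complex a t * of_real (S \<pi>))) = exp (a * S \<pi>)" by simp
    with mult_left_mono[OF le, of "exp (a * S \<pi>)"]
    show "norm (exp (Complex a t * of_real (S \<pi>)) * (\<Prod>k<m. (1 + exp (- 2 * Complex a t * of_real (D k \<pi>))) / 2))
      \<le> U \<pi> * exp (a * of_real (S \<pi>)) * (\<Prod>k<m. (1 + exp (- 2 * a * of_real (D k \<pi>))) / 2)"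
      unfolding norm_mult by (simp add: mult_ac)
  qed
  \<comment> \<open>The symmetrisation run backwards, with the real exponent \<open>a\<close> and
    the weight \<open>U\<close>.\<close>
  also have "\<dots> = (\<Sum>\<pi>\<in>Perms n. U \<pi> * exp (a * of_real (S \<pi>)))"
    unfolding S_def D_def by (rule symmetrized_exp_sum[OF p, symmetric]) (rule Uinv)
  also have "\<dots> = (\<Sum>\<pi>\<in>Perms n. exp (a * S \<pi>) * U \<pi>)" by (simp add: mult.commute)
  also have "\<dots> \<le> sqrt ((\<Sum>\<pi>\<in>Perms n. (exp (a * S \<pi>))\<^sup>2) * (\<Sum>\<pi>\<in>Perms n. (U \<pi>)\<^sup>2))"
    by (intro real_le_rsqrt Cauchy_Schwarz_ineq_sum)
  also have "\<dots> = sqrt (\<Sum>\<pi>\<in>Perms n. (exp (a * S \<pi>))\<^sup>2) * sqrt (\<Sum>\<pi>\<in>Perms n. (U \<pi>)\<^sup>2)"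
    by (rule real_sqrt_mult)
  also have "(\<Sum>\<pi>\<in>Perms n. (exp (a * S \<pi>))\<^sup>2) = (\<Sum>\<pi>\<in>Perms n. exp (2 * a * S \<pi>))"
    by (simp add: exp_double[symmetric] mult.assoc)
  also have "(\<Sum>\<pi>\<in>Perms n. (U \<pi>)\<^sup>2) = (\<Sum>\<pi>\<in>Perms n. \<Prod>k<m. 1 - exp (- 2) * (sin (t * D k \<pi>))\<^sup>2)"
    unfolding U_def prod_power_distrib g_def by (simp add: arg)
  finally show ?thesis by (simp add: S_def D_def)
qed

section \<open>Subgaussian bound for the exponential moments\<close>

text \<open>Exchangeable pairs: as the weights sum to zero, \<open>2 * n * S\<close> is the sum of
  the swap differences over all ordered pairs of positions. So \<open>m'\<close> is a sum of
  antisymmetric terms, each controlled by its own swap. This gives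
  \<open>m' x \<le> 4 * C^2 * x * m x\<close>, which integrates to the Gaussian bound.\<close>

lemma subgaussian_nonneg:
  fixes w v :: "nat \<Rightarrow> real"
  assumes n: "n \<ge> 1" and w: "(\<Sum>i=1..n. w i) = 0" "(\<Sum>i=1..n. (w i)\<^sup>2) = 1"
    and v: "\<And>i. i \<in> {1..n} \<Longrightarrow> \<bar>v i\<bar> \<le> C" and "0 \<le> a"
  shows "(\<Sum>\<pi>\<in>Perms n. exp (a * perm_sum n w v \<pi>)) \<le> fact n * exp (2 * C\<^sup>2 * a\<^sup>2)"
proof -
  define S where "S = perm_sum n w v"
  define m where "m x = (\<Sum>\<pi>\<in>Perms n. exp (x * S \<pi>))" for x
  define m' where "m' x = (\<Sum>\<pi>\<in>Perms n. S \<pi> * exp (x * S \<pi>))" for x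
  have tot: "(\<Sum>i\<in>{1..n}. \<Sum>j\<in>{1..n}. (w i - w j) * (u i - u j)) = 2 * real n * (\<Sum>i\<in>{1..n}. w i * u i)" for u :: "nat \<Rightarrow> real"
  proof -
    have "(\<Sum>i\<in>{1..n}. \<Sum>j\<in>{1..n}. (w i - w j) * (u i - u j))
      = (\<Sum>i\<in>{1..n}. \<Sum>j\<in>{1..n}. w i * u i - w i * u j - u i * w j + w j * u j)"
      by (simp add: algebra_simps)
    also have "\<dots> = (\<Sum>i\<in>{1..n}. real n * (w i * u i) - w i * (\<Sum>j\<in>{1..n}. u j) + (\<Sum>j\<in>{1..n}. w j * u j))"
      using w by (simp add: sum.distrib sum_subtractf sum_distrib_left[symmetric])
    also have "\<dots> = real n * (\<Sum>i\<in>{1..n}. w i * u i) - (\<Sum>i\<in>{1..n}. w i) * (\<Sum>j\<in>{1..n}. u j) + real n * (\<Sum>i\<in>{1..n}. w i * u i)"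
      by (simp add: sum.distrib sum_subtractf sum_distrib_left[symmetric] sum_distrib_right[symmetric])
    finally show ?thesis using w by simp
  qed
  have pair: "(\<Sum>\<pi>\<in>Perms n. (w i - w j) * (v (\<pi> i) - v (\<pi> j)) * exp (x * S \<pi>)) \<le> 4 * C\<^sup>2 * x * (w i - w j)\<^sup>2 * m x"
    if ij: "i \<in> {1..n}" "j \<in> {1..n}" and x: "0 \<le> x" for i j x
  proof -
    define \<tau> where "\<tau> = Transposition.transpose i j"
    define \<Delta> where "\<Delta> \<pi> = (w i - w j) * (v (\<pi> i) - v (\<pi> j))" for \<pi>
    have \<tau>: "\<tau> permutes {1..n}" unfolding \<tau>_def using ij by (rule permutes_swap_id)
    have S\<tau>: "S (\<pi> \<circ> \<tau>) = S \<pi> - \<Delta> \<pi>" for \<pi>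
      unfolding S_def \<tau>_def \<Delta>_def using ij by (rule perm_sum_transpose)
    have \<Delta>\<tau>: "\<Delta> (\<pi> \<circ> \<tau>) = - \<Delta> \<pi>" for \<pi> by (simp add: \<Delta>_def \<tau>_def algebra_simps)
    have inv: "(\<Sum>\<pi>\<in>Perms n. f (\<pi> \<circ> \<tau>)) = (\<Sum>\<pi>\<in>Perms n. f \<pi>)" for f :: "_ \<Rightarrow> real"
      using sum_Perms_comp[OF \<tau>] .
    \<comment> \<open>Uses \<open>1 - exp (- u) \<le> u\<close> after factoring out the larger
      exponential: \<open>exp s\<close> if \<open>D \<ge> 0\<close>, the other one if not.\<close>
    have key: "D * (exp s - exp (s - x * D)) \<le> x * D\<^sup>2 * (exp s + exp (s - x * D))" for D s :: real
    proof (cases "0 \<le> D")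
      case True
      have "1 - exp (- (x * D)) \<le> x * D" using exp_ge_add_one_self[of "- (x * D)"] by linarith
      then have "D * exp s * (1 - exp (- (x * D))) \<le> D * exp s * (x * D)" using True by (intro mult_left_mono) auto
      moreover have "0 \<le> x * D\<^sup>2 * exp (s - x * D)" using x by simp
      moreover have "exp (s - x * D) = exp s * exp (- (x * D))" by (simp add: exp_add[symmetric])
      ultimately show ?thesis by (simp add: algebra_simps power2_eq_square)
    next
      case False
      have "1 - exp (x * D) \<le> - (x * D)" using exp_ge_add_one_self[of "x * D"] by linarith
      then have "(- D) * exp (s - x * D) * (1 - exp (x * D)) \<le> (- D) * exp (s - x * D) * (- (x * D))"
        using False by (intro mult_left_mono mult_nonneg_nonneg) auto
      moreover have "0 \<le> x * D\<^sup>2 * exp s" using x by simp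
      moreover have "exp s = exp (s - x * D) * exp (x * D)" by (simp add: exp_add[symmetric])
      ultimately show ?thesis by (simp add: algebra_simps power2_eq_square)
    qed
    \<comment> \<open>Antisymmetry of \<open>\<Delta>\<close> under the swap turns the sum into one
      over differences of exponentials, which gains a further factor
      \<open>x * \<Delta>\<close>.\<close>
    have "2 * (\<Sum>\<pi>\<in>Perms n. \<Delta> \<pi> * exp (x * S \<pi>))
      = (\<Sum>\<pi>\<in>Perms n. \<Delta> \<pi> * exp (x * S \<pi>)) + (\<Sum>\<pi>\<in>Perms n. \<Delta> (\<pi> \<circ> \<tau>) * exp (x * S (\<pi> \<circ> \<tau>)))"
      using inv[of "\<lambda>\<pi>. \<Delta> \<pi> * exp (x * S \<pi>)"] by simp
    also have "\<dots> = (\<Sum>\<pi>\<in>Perms n. \<Delta> \<pi> * (exp (x * S \<pi>) - exp (x * S \<pi> - x * \<Delta> \<pi>)))"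
      unfolding sum.distrib[symmetric] by (intro sum.cong refl) (simp add: \<Delta>\<tau> S\<tau> algebra_simps)
    also have "\<dots> \<le> (\<Sum>\<pi>\<in>Perms n. x * (\<Delta> \<pi>)\<^sup>2 * (exp (x * S \<pi>) + exp (x * S \<pi> - x * \<Delta> \<pi>)))"
      by (intro sum_mono key)
    also have "\<dots> = (\<Sum>\<pi>\<in>Perms n. x * (\<Delta> \<pi>)\<^sup>2 * exp (x * S \<pi>)) + (\<Sum>\<pi>\<in>Perms n. x * (\<Delta> (\<pi> \<circ> \<tau>))\<^sup>2 * exp (x * S (\<pi> \<circ> \<tau>)))"
      unfolding sum.distrib[symmetric] by (intro sum.cong refl) (simp add: \<Delta>\<tau> S\<tau> algebra_simps)
    also have "\<dots> = 2 * (\<Sum>\<pi>\<in>Perms n. x * (\<Delta> \<pi>)\<^sup>2 * exp (x * S \<pi>))"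
      using inv[of "\<lambda>\<pi>. x * (\<Delta> \<pi>)\<^sup>2 * exp (x * S \<pi>)"] by simp
    finally have "(\<Sum>\<pi>\<in>Perms n. \<Delta> \<pi> * exp (x * S \<pi>)) \<le> (\<Sum>\<pi>\<in>Perms n. x * (\<Delta> \<pi>)\<^sup>2 * exp (x * S \<pi>))" by simp
    also have "\<dots> \<le> (\<Sum>\<pi>\<in>Perms n. 4 * C\<^sup>2 * x * (w i - w j)\<^sup>2 * exp (x * S \<pi>))"
    proof (intro sum_mono mult_right_mono)
      fix \<pi> assume \<pi>: "\<pi> \<in> Perms n"
      have "\<bar>v (\<pi> i) - v (\<pi> j)\<bar> \<le> 2 * C" using v[OF Perms_in[OF \<pi> ij(1)]] v[OF Perms_in[OF \<pi> ij(2)]] by linarith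
      then have "(v (\<pi> i) - v (\<pi> j))\<^sup>2 \<le> (2 * C)\<^sup>2" by (metis abs_ge_zero power2_abs power_mono)
      then have "x * ((w i - w j)\<^sup>2 * (v (\<pi> i) - v (\<pi> j))\<^sup>2) \<le> x * ((w i - w j)\<^sup>2 * (2 * C)\<^sup>2)"
        using x by (intro mult_left_mono) auto
      then show "x * (\<Delta> \<pi>)\<^sup>2 \<le> 4 * C\<^sup>2 * x * (w i - w j)\<^sup>2" by (simp add: \<Delta>_def power_mult_distrib mult_ac)
    qed auto
    also have "\<dots> = 4 * C\<^sup>2 * x * (w i - w j)\<^sup>2 * m x" by (simp add: m_def sum_distrib_left)
    finally show ?thesis by (simp add: \<Delta>_def)
  qed
  have ode: "m' x \<le> 4 * C\<^sup>2 * x * m x" if x: "0 \<le> x" for x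
  proof -
    have "2 * real n * m' x = (\<Sum>\<pi>\<in>Perms n. (\<Sum>i\<in>{1..n}. \<Sum>j\<in>{1..n}. (w i - w j) * (v (\<pi> i) - v (\<pi> j))) * exp (x * S \<pi>))"
      unfolding m'_def sum_distrib_left
    proof (intro sum.cong refl)
      fix \<pi>
      show "2 * real n * (S \<pi> * exp (x * S \<pi>)) = (\<Sum>i\<in>{1..n}. \<Sum>j\<in>{1..n}. (w i - w j) * (v (\<pi> i) - v (\<pi> j))) * exp (x * S \<pi>)"
        using tot[of "\<lambda>i. v (\<pi> i)"] by (simp add: S_def perm_sum_def)
    qed
    also have "\<dots> = (\<Sum>\<pi>\<in>Perms n. \<Sum>i\<in>{1..n}. \<Sum>j\<in>{1..n}. (w i - w j) * (v (\<pi> i) - v (\<pi> j)) * exp (x * S \<pi>))"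
      by (simp add: sum_distrib_right)
    also have "\<dots> = (\<Sum>i\<in>{1..n}. \<Sum>\<pi>\<in>Perms n. \<Sum>j\<in>{1..n}. (w i - w j) * (v (\<pi> i) - v (\<pi> j)) * exp (x * S \<pi>))"
      by (rule sum.swap)
    also have "\<dots> = (\<Sum>i\<in>{1..n}. \<Sum>j\<in>{1..n}. \<Sum>\<pi>\<in>Perms n. (w i - w j) * (v (\<pi> i) - v (\<pi> j)) * exp (x * S \<pi>))"
      by (intro sum.cong refl sum.swap)
    also have "\<dots> \<le> (\<Sum>i\<in>{1..n}. \<Sum>j\<in>{1..n}. 4 * C\<^sup>2 * x * (w i - w j)\<^sup>2 * m x)"
      using x by (intro sum_mono pair) auto
    also have "\<dots> = 4 * C\<^sup>2 * x * (\<Sum>i\<in>{1..n}. \<Sum>j\<in>{1..n}. (w i - w j) * (w i - w j)) * m x"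
      by (simp add: sum_distrib_left sum_distrib_right power2_eq_square)
    also have "(\<Sum>i\<in>{1..n}. \<Sum>j\<in>{1..n}. (w i - w j) * (w i - w j)) = 2 * real n"
      using tot[of w] w(2) by (simp add: power2_eq_square)
    finally have "2 * real n * m' x \<le> 2 * real n * (4 * C\<^sup>2 * x * m x)" by (simp add: mult_ac)
    then show ?thesis using n by (simp add: mult_ac)
  qed
  have "m a * exp (- (2 * C\<^sup>2 * a\<^sup>2)) \<le> m 0 * exp (- (2 * C\<^sup>2 * 0\<^sup>2))"
  proof (rule DERIV_nonpos_imp_nonincreasing[OF \<open>0 \<le> a\<close>])
    fix x :: real assume x: "0 \<le> x" "x \<le> a"
    have dm: "(m has_real_derivative m' x) (at x)"
      unfolding m_def[abs_def] m'_def by (auto intro!: derivative_eq_intros DERIV_sum sum.cong)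
    have "((\<lambda>x. m x * exp (- (2 * C\<^sup>2 * x\<^sup>2))) has_real_derivative
        m' x * exp (- (2 * C\<^sup>2 * x\<^sup>2)) + m x * (exp (- (2 * C\<^sup>2 * x\<^sup>2)) * (- (4 * C\<^sup>2 * x)))) (at x)"
      by (auto intro!: derivative_eq_intros dm)
    moreover have "m' x * exp (- (2 * C\<^sup>2 * x\<^sup>2)) + m x * (exp (- (2 * C\<^sup>2 * x\<^sup>2)) * (- (4 * C\<^sup>2 * x)))
      = (m' x - 4 * C\<^sup>2 * x * m x) * exp (- (2 * C\<^sup>2 * x\<^sup>2))" by (simp add: algebra_simps)
    moreover have "(m' x - 4 * C\<^sup>2 * x * m x) * exp (- (2 * C\<^sup>2 * x\<^sup>2)) \<le> 0"
      using ode[OF x(1)] by (intro mult_nonpos_nonneg) auto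
    ultimately show "\<exists>y. ((\<lambda>x. m x * exp (- (2 * C\<^sup>2 * x\<^sup>2))) has_real_derivative y) (at x) \<and> y \<le> 0"
      by (intro exI conjI) simp_all
  qed
  then have "m a * exp (- (2 * C\<^sup>2 * a\<^sup>2)) * exp (2 * C\<^sup>2 * a\<^sup>2) \<le> m 0 * exp (2 * C\<^sup>2 * a\<^sup>2)"
    by (intro mult_right_mono) auto
  then show ?thesis by (simp add: m_def S_def card_Perms mult.assoc exp_add[symmetric])
qed

lemma subgaussian:
  fixes w v :: "nat \<Rightarrow> real"
  assumes n: "n \<ge> 1" and w: "(\<Sum>i=1..n. w i) = 0" "(\<Sum>i=1..n. (w i)\<^sup>2) = 1"
    and v: "\<And>i. i \<in> {1..n} \<Longrightarrow> \<bar>v i\<bar> \<le> C"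
  shows "(\<Sum>\<pi>\<in>Perms n. exp (a * perm_sum n w v \<pi>)) \<le> fact n * exp (2 * C\<^sup>2 * a\<^sup>2)"
proof (cases "0 \<le> a")
  case True
  then show ?thesis using subgaussian_nonneg[OF n w, of v C a] v by blast
next
  case False
  have "(\<Sum>\<pi>\<in>Perms n. exp ((- a) * perm_sum n (\<lambda>i. - w i) v \<pi>)) \<le> fact n * exp (2 * C\<^sup>2 * (- a)\<^sup>2)"
    using False w by (intro subgaussian_nonneg[OF n _ _ v]) (auto simp: sum_negf)
  then show ?thesis by (simp add: perm_sum_def sum_negf)
qed

section \<open>Decay of the tilted characteristic function\<close>

text \<open>For each fixed \<open>x\<close>, \<open>s * v x\<close> serves as the phase
  \<open>\<theta>\<close>: of the at least \<open>\<delta> * n / 2\<close> indices in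
  \<open>J\<close> at most \<open>\<delta> * n / 4\<close> are bad, and each of the others
  contributes at least the squared threshold.\<close>

lemma sum_sin_sq_ge:
  fixes v :: "nat \<Rightarrow> real" and \<delta> \<epsilon> s :: real
  assumes J: "finite J" "real (card J) \<ge> \<delta> * real n / 2" and "0 \<le> \<delta>" "0 < \<epsilon>"
    and spread: "\<And>\<theta>. real (card {i\<in>J. \<bar>sin (s * v i - \<theta>)\<bar> < \<epsilon> * min 1 \<bar>s\<bar>}) \<le> \<delta> * real n / 4"
  shows "\<delta>\<^sup>2 * \<epsilon>\<^sup>2 / 8 * (min 1 \<bar>s\<bar>)\<^sup>2 * (real n)\<^sup>2 \<le> (\<Sum>x\<in>J. \<Sum>y\<in>J. (sin (s * (v x - v y)))\<^sup>2)"
proof -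
  define u where "u = \<epsilon> * min 1 \<bar>s\<bar>"
  have u0: "0 \<le> u" using assms by (simp add: u_def)
  have inner: "\<delta> * real n / 4 * u\<^sup>2 \<le> (\<Sum>y\<in>J. (sin (s * (v x - v y)))\<^sup>2)" for x
  proof -
    define K where "K = {y\<in>J. \<bar>sin (s * v y - s * v x)\<bar> < u}"
    have K: "K \<subseteq> J" "real (card K) \<le> \<delta> * real n / 4" using spread by (auto simp: K_def u_def)
    have "\<delta> * real n / 4 \<le> real (card J) - real (card K)" using J K by linarith
    also have "\<dots> = real (card (J - K))"
      using K J by (simp add: card_Diff_subset finite_subset of_nat_diff card_mono)
    finally have "\<delta> * real n / 4 * u\<^sup>2 \<le> real (card (J - K)) * u\<^sup>2" by (intro mult_right_mono) auto
    also have "\<dots> = (\<Sum>y\<in>J - K. u\<^sup>2)" by simp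
    also have "\<dots> \<le> (\<Sum>y\<in>J - K. (sin (s * (v x - v y)))\<^sup>2)"
    proof (intro sum_mono)
      fix y assume "y \<in> J - K"
      then have "u \<le> \<bar>sin (s * v y - s * v x)\<bar>" by (auto simp: K_def)
      also have "s * v y - s * v x = - (s * (v x - v y))" by (simp add: algebra_simps)
      finally have "u \<le> \<bar>sin (s * (v x - v y))\<bar>" by (simp only: sin_minus abs_minus_cancel)
      with u0 have "u\<^sup>2 \<le> \<bar>sin (s * (v x - v y))\<bar>\<^sup>2" by (intro power_mono)
      then show "u\<^sup>2 \<le> (sin (s * (v x - v y)))\<^sup>2" by simp
    qed
    also have "\<dots> \<le> (\<Sum>y\<in>J. (sin (s * (v x - v y)))\<^sup>2)" using J K by (intro sum_mono2) auto
    finally show ?thesis .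
  qed
  have "\<delta>\<^sup>2 * \<epsilon>\<^sup>2 / 8 * (min 1 \<bar>s\<bar>)\<^sup>2 * (real n)\<^sup>2 = (\<delta> * real n / 2) * (\<delta> * real n / 4 * u\<^sup>2)"
    by (simp add: u_def power2_eq_square)
  also have "\<dots> \<le> real (card J) * (\<delta> * real n / 4 * u\<^sup>2)" using J assms by (intro mult_right_mono) auto
  also have "\<dots> = (\<Sum>x\<in>J. \<delta> * real n / 4 * u\<^sup>2)" by simp
  also have "\<dots> \<le> (\<Sum>x\<in>J. \<Sum>y\<in>J. (sin (s * (v x - v y)))\<^sup>2)" by (intro sum_mono inner)
  finally show ?thesis .
qed

lemma spread_pair_le:
  assumes "spread_weights A n w" "0 < A" "n \<ge> 2" "i \<in> {1..n}" "j \<in> {1..n}"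
  shows "A * sqrt (ln (real n)) * \<bar>w i - w j\<bar> \<le> 1"
proof -
  have "0 < A * sqrt (ln (real n))" using assms by simp
  moreover have "\<bar>w i - w j\<bar> \<le> 1 / (A * sqrt (ln (real n)))" if "i \<noteq> j"
    using assms that unfolding spread_weights_def by blast
  ultimately show ?thesis by (cases "i = j") (auto simp: field_simps)
qed

text \<open>With \<open>T = A * sqrt (ln n)\<close> the weight condition reads
  \<open>|\<Delta> k| \<le> 1 / T\<close>. So for \<open>|t| \<le> T\<close> every
  \<open>min 1 |s k|\<close> equals \<open>|s k|\<close> and the gains add up to a multiple of
  \<open>t^2\<close>; for larger \<open>|t|\<close> only the gain at \<open>T\<close> is
  kept.\<close>

lemma tilted_exp_sum_decay:
  fixes d :: nat and \<delta> b B :: real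
  assumes "d \<ge> 2" "\<delta> > 0" "b \<noteq> 0" "B > 0"
  shows "\<exists>c>0. \<exists>A\<^sub>1\<ge>1. \<exists>N. \<forall>A\<ge>A\<^sub>1. \<forall>n\<ge>N. \<forall>w I v a t. spread_weights A n w \<longrightarrow> I \<subseteq> {1..n} \<longrightarrow>
    real (card I) \<ge> \<delta> * real n \<longrightarrow> poly_on d b B n I v \<longrightarrow>
    (\<forall>x\<in>{1..n}. \<forall>y\<in>{1..n}. \<bar>a\<bar> * \<bar>v x - v y\<bar> \<le> 2 * sqrt (ln (real n))) \<longrightarrow> \<bar>t\<bar> \<le> real n \<longrightarrow>
    norm (\<Sum>\<pi>\<in>Perms n. exp (Complex a t * of_real (perm_sum n w v \<pi>)))
      \<le> sqrt (fact n) * sqrt (\<Sum>\<pi>\<in>Perms n. exp (2 * a * perm_sum n w v \<pi>)) *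
        exp (- c * (min \<bar>t\<bar> (A * sqrt (ln (real n))))\<^sup>2)"
proof -
  define spread_at where "spread_at \<epsilon> \<sigma> n \<longleftrightarrow> (\<forall>I v s \<theta>. I \<subseteq> {1..n} \<longrightarrow> real (card I) \<ge> \<delta> * real n \<longrightarrow>
      poly_on d b B n I v \<longrightarrow> \<bar>s\<bar> \<le> \<sigma> * real n \<longrightarrow>
      real (card {i\<in>I. \<bar>sin (s * v i - \<theta>)\<bar> < \<epsilon> * min 1 \<bar>s\<bar>}) \<le> \<delta> * real n / 4)" for \<epsilon> \<sigma> n
  have "\<exists>\<epsilon>>0. \<epsilon> \<le> 1 \<and> (\<exists>\<sigma>>0. \<exists>N. \<forall>n\<ge>N. spread_at \<epsilon> \<sigma> n)"
    unfolding spread_at_def by (rule poly_values_spread[OF assms])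
  then obtain \<epsilon> \<sigma> N0 where e: "0 < \<epsilon>" "\<epsilon> \<le> 1" and \<sigma>: "0 < \<sigma>" and at: "\<And>n. n \<ge> N0 \<Longrightarrow> spread_at \<epsilon> \<sigma> n"
    by blast
  have spread: "real (card {i\<in>I. \<bar>sin (s * v i - \<theta>)\<bar> < \<epsilon> * min 1 \<bar>s\<bar>}) \<le> \<delta> * real n / 4"
    if "n \<ge> N0" "I \<subseteq> {1..n}" "real (card I) \<ge> \<delta> * real n" "poly_on d b B n I v" "\<bar>s\<bar> \<le> \<sigma> * real n" for n I v s \<theta>
    using at[OF that(1), unfolded spread_at_def, rule_format, OF that(2-)] .
  define \<kappa> where "\<kappa> = exp (- 2 :: real)"
  have \<kappa>: "0 < \<kappa>" "\<kappa> \<le> 1" by (auto simp: \<kappa>_def)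
  define c0 where "c0 = \<kappa> * (\<delta>\<^sup>2 * \<epsilon>\<^sup>2 / 8)"
  have c0: "0 < c0" using \<kappa> e assms by (simp add: c0_def)
  \<comment> \<open>The \<open>\<eta> k\<close> sum to at least
    \<open>c0 / 4 * (\<delta> / 8)\<close> times the squared truncated frequency; the square root
    from Cauchy-Schwarz halves this, whence 64.\<close>
  define c where "c = c0 * \<delta> / 64"
  have c: "0 < c" using c0 assms by (simp add: c_def)
  \<comment> \<open>\<open>A \<ge> 1 / \<sigma>\<close> yields
    \<open>|\<Delta> k| \<le> \<sigma>\<close>, so that \<open>|t| \<le> n\<close> keeps
    \<open>s k\<close> in the range of \<open>poly_values_spread\<close>; \<open>A \<ge> 1\<close>
    is for the tilt.\<close>
  define A1 where "A1 = max 1 (1 / \<sigma>)"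
  define N where "N = max N0 (max 3 (nat \<lceil>16 / \<delta>\<rceil>))"
  show ?thesis
  proof (rule exI[of _ c], rule conjI[OF c], rule exI[of _ A1], rule conjI, simp add: A1_def,
      rule exI[of _ N], intro allI impI)
    fix A n w I v a t
    assume A: "A1 \<le> A" and n: "N \<le> n" and sw: "spread_weights A n w" and I: "I \<subseteq> {1..n}" "\<delta> * real n \<le> real (card I)"
      and po: "poly_on d b B n I v"
      and tilt: "\<forall>x\<in>{1..n}. \<forall>y\<in>{1..n}. \<bar>a\<bar> * \<bar>v x - v y\<bar> \<le> 2 * sqrt (ln (real n))"
      and t: "\<bar>t\<bar> \<le> real n"
    have A1: "1 \<le> A" "1 / \<sigma> \<le> A" using A by (auto simp: A1_def)
    have n3: "3 \<le> n" "N0 \<le> n" using n by (auto simp: N_def)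
    have n16: "16 \<le> \<delta> * real n"
    proof -
      have "16 / \<delta> \<le> real (nat \<lceil>16 / \<delta>\<rceil>)" by linarith
      also have "\<dots> \<le> real n" using n by (simp add: N_def)
      finally show ?thesis using assms by (simp add: field_simps)
    qed
    have ln1: "1 \<le> ln (real n)"
    proof -
      have "exp 1 \<le> real n" using exp_le n3 by linarith
      then show ?thesis using n3 by (subst ln_ge_iff) auto
    qed
    define T where "T = A * sqrt (ln (real n))"
    have T: "1 / \<sigma> \<le> T"
      using mult_mono[of "1 / \<sigma>" A 1 "sqrt (ln (real n))"] A1 ln1 \<sigma> by (simp add: T_def)
    have T0: "0 < T" using T \<sigma> by (smt (verit) divide_pos_pos)
    have TD: "T * \<bar>w i - w j\<bar> \<le> 1" if "i \<in> {1..n}" "j \<in> {1..n}" for i j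
      unfolding T_def using spread_pair_le[OF sw _ _ that] A1 n3 by simp
    have dn: "\<delta> \<le> 1"
    proof -
      have "card I \<le> n" using card_mono[OF _ I(1)] by simp
      then have "\<delta> * real n \<le> 1 * real n" using I(2) by linarith
      then show ?thesis using n3 by simp
    qed
    \<comment> \<open>Few enough pairs that deleting \<open>2 * m\<close> values from
      \<open>I\<close> leaves at least \<open>\<delta> * n / 2\<close>, and enough of them that
      their squared weight differences sum to at least \<open>\<delta> / 8\<close>.\<close>
    define m where "m = nat \<lfloor>\<delta> * real n / 8\<rfloor>"
    have m: "real m \<le> \<delta> * real n / 8" "\<delta> * real n / 16 \<le> real m"
      using n16 unfolding m_def by linarith+
    have "\<delta> * real n \<le> 1 * real n" using dn by (intro mult_right_mono) auto
    then have m2: "2 * m \<le> n" using m by linarith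
    obtain p where p: "inj_on p {..<2*m}" "p ` {..<2*m} \<subseteq> {1..n}"
      and pw: "2 * real m / real n \<le> (\<Sum>k<m. (w (p (2*k)) - w (p (2*k+1)))\<^sup>2)"
      using exists_spread_pairing[of n m w] m2 sw n3 unfolding spread_weights_def by auto
    have pin: "p (2*k) \<in> {1..n}" "p (2*k+1) \<in> {1..n}" if "k < m" for k
      using that image_subset_iff[THEN iffD1, OF p(2)] by auto
    define \<Delta> where "\<Delta> k = w (p (2*k)) - w (p (2*k+1))" for k
    define s where "s k = t * (\<Delta> k / 2)" for k
    define \<eta> where "\<eta> k = c0 * (min 1 \<bar>s k\<bar>)\<^sup>2" for k
    have \<eta>1: "\<eta> k \<le> 1" for k
    proof -
      have "c0 \<le> 1 * (1 * 1 / 8)" unfolding c0_def using \<kappa> e assms dn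
        by (intro mult_mono divide_right_mono) (auto simp: power_le_one)
      moreover have "(min 1 \<bar>s k\<bar>)\<^sup>2 \<le> 1" by (simp add: power_le_one)
      ultimately show ?thesis unfolding \<eta>_def using c0 by (intro mult_le_one) auto
    qed
    have \<Delta>: "T * \<bar>\<Delta> k\<bar> \<le> 1" if "k < m" for k unfolding \<Delta>_def using TD pin[OF that] by blast
    have ssmall: "\<bar>s k\<bar> \<le> \<sigma> * real n" if k: "k < m" for k
    proof -
      have "1 / \<sigma> * \<bar>\<Delta> k\<bar> \<le> T * \<bar>\<Delta> k\<bar>" using T by (intro mult_right_mono) auto
      with \<Delta>[OF k] have "1 / \<sigma> * \<bar>\<Delta> k\<bar> \<le> 1" by linarith
      then have "\<bar>\<Delta> k\<bar> \<le> \<sigma>" using \<sigma> by (simp add: field_simps)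
      then have "\<bar>t\<bar> * \<bar>\<Delta> k\<bar> \<le> real n * \<sigma>" using t by (intro mult_mono) auto
      moreover have "\<bar>s k\<bar> = \<bar>t\<bar> * \<bar>\<Delta> k\<bar> / 2" by (simp add: s_def abs_mult)
      moreover have "0 \<le> real n * \<sigma>" using \<sigma> by simp
      ultimately show ?thesis by (simp add: mult.commute)
    qed
    \<comment> \<open>The bound \<open>2 * sqrt (ln n)\<close> on the tilted values meets
      \<open>1 / (A * sqrt (ln n))\<close> on the weight difference; the half in
      \<open>swap_gain\<close> brings the product down to 1.\<close>
    have small: "\<bar>a * swap_gain w v p k \<pi>\<bar> \<le> 1" if \<pi>: "\<pi> \<in> Perms n" and k: "k < m" for \<pi> k
    proof -
      have sq: "0 < sqrt (ln (real n))" using ln1 by simp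
      have "\<bar>a\<bar> * \<bar>v (\<pi> (p (2*k))) - v (\<pi> (p (2*k+1)))\<bar> \<le> 2 * sqrt (ln (real n))"
        using tilt Perms_in[OF \<pi>] pin[OF k] by blast
      then have "\<bar>\<Delta> k\<bar> * (\<bar>a\<bar> * \<bar>v (\<pi> (p (2*k))) - v (\<pi> (p (2*k+1)))\<bar>) \<le> \<bar>\<Delta> k\<bar> * (2 * sqrt (ln (real n)))"
        by (intro mult_left_mono) auto
      also have "\<dots> = 2 * (1 * (\<bar>\<Delta> k\<bar> * sqrt (ln (real n))))" by simp
      also have "\<dots> \<le> 2 * (A * (\<bar>\<Delta> k\<bar> * sqrt (ln (real n))))"
        using A1 sq by (intro mult_left_mono mult_right_mono mult_nonneg_nonneg) auto
      also have "\<dots> = 2 * (T * \<bar>\<Delta> k\<bar>)" by (simp add: T_def)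
      also have "\<dots> \<le> 2" using \<Delta>[OF k] by simp
      finally show ?thesis by (simp add: swap_gain_def \<Delta>_def abs_mult mult_ac)
    qed
    define f where "f k x y = 1 - \<kappa> * (sin (s k * (v x - v y)))\<^sup>2" for k x y
    have f: "0 \<le> f k x y" "f k x y \<le> 1" "f k x x = 1" for k x y
      using \<kappa> mult_mono[of \<kappa> 1 "(sin (s k * (v x - v y)))\<^sup>2" 1] by (auto simp: f_def abs_square_le_1)
    have "(\<Sum>\<pi>\<in>Perms n. \<Prod>k<m. f k (\<pi> (p (2*k))) (\<pi> (p (2*k+1)))) \<le> fact n * (\<Prod>k<m. 1 - \<eta> k)"
    proof (rule prod_pairs_bound[OF _ p f])
      show "1 \<le> n" using n3 by simp
      show "\<eta> k \<le> 1" for k by (rule \<eta>1)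
    next
      fix k W assume k: "k < m" and W: "W \<subseteq> {1..n}" "card W \<le> 2 * m"
      define J where "J = I - W"
      have fin: "finite I" "finite W" using I W finite_subset by auto
      have cJ: "real (card J) \<ge> \<delta> * real n / 2"
      proof -
        have "card I - card W \<le> card J" unfolding J_def using fin by (intro diff_card_le_card_Diff)
        then show ?thesis using I(2) W(2) m n16 by linarith
      qed
      have "\<delta>\<^sup>2 * \<epsilon>\<^sup>2 / 8 * (min 1 \<bar>s k\<bar>)\<^sup>2 * (real n)\<^sup>2 \<le> (\<Sum>x\<in>J. \<Sum>y\<in>J. (sin (s k * (v x - v y)))\<^sup>2)"
      proof (rule sum_sin_sq_ge[OF _ cJ _ e(1)])
        fix \<theta>
        have "card {i\<in>J. \<bar>sin (s k * v i - \<theta>)\<bar> < \<epsilon> * min 1 \<bar>s k\<bar>} \<le> card {i\<in>I. \<bar>sin (s k * v i - \<theta>)\<bar> < \<epsilon> * min 1 \<bar>s k\<bar>}"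
          using fin by (intro card_mono) (auto simp: J_def)
        then show "real (card {i\<in>J. \<bar>sin (s k * v i - \<theta>)\<bar> < \<epsilon> * min 1 \<bar>s k\<bar>}) \<le> \<delta> * real n / 4"
          using spread[OF n3(2) I po ssmall[OF k], of \<theta>] by linarith
      qed (use fin assms in \<open>auto simp: J_def\<close>)
      then have "\<kappa> * (\<delta>\<^sup>2 * \<epsilon>\<^sup>2 / 8 * (min 1 \<bar>s k\<bar>)\<^sup>2 * (real n)\<^sup>2) \<le> \<kappa> * (\<Sum>x\<in>J. \<Sum>y\<in>J. (sin (s k * (v x - v y)))\<^sup>2)"
        using \<kappa> by (intro mult_left_mono) auto
      also have "\<dots> = (\<Sum>x\<in>J. \<Sum>y\<in>J. 1 - f k x y)" by (simp add: f_def sum_distrib_left)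
      also have "\<dots> \<le> (\<Sum>x\<in>J. \<Sum>y\<in>{1..n}-W. 1 - f k x y)"
        using f I by (intro sum_mono sum_mono2) (auto simp: J_def)
      also have "\<dots> \<le> (\<Sum>x\<in>{1..n}-W. \<Sum>y\<in>{1..n}-W. 1 - f k x y)"
        using f I by (intro sum_mono2 sum_nonneg) (auto simp: J_def)
      finally show "\<eta> k * (real n)\<^sup>2 \<le> (\<Sum>x\<in>{1..n}-W. \<Sum>y\<in>{1..n}-W. 1 - f k x y)"
        by (simp add: \<eta>_def c0_def mult.assoc)
    qed
    also have "(\<Prod>k<m. 1 - \<eta> k) \<le> exp (- (2 * c * (min \<bar>t\<bar> T)\<^sup>2))"
    proof -
      define \<mu> where "\<mu> = min \<bar>t\<bar> T"
      have \<mu>0: "0 \<le> \<mu>" using T0 by (simp add: \<mu>_def)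
      have lo: "c0 / 4 * \<mu>\<^sup>2 * (\<Delta> k)\<^sup>2 \<le> \<eta> k" if k: "k < m" for k
      proof -
        have "\<mu> * \<bar>\<Delta> k\<bar> \<le> T * \<bar>\<Delta> k\<bar>" "\<mu> * \<bar>\<Delta> k\<bar> \<le> \<bar>t\<bar> * \<bar>\<Delta> k\<bar>"
          by (intro mult_right_mono; simp add: \<mu>_def)+
        then have "\<mu> * \<bar>\<Delta> k\<bar> / 2 \<le> min 1 \<bar>s k\<bar>" using \<Delta>[OF k] by (simp add: s_def abs_mult)
        then have "(\<mu> * \<bar>\<Delta> k\<bar> / 2)\<^sup>2 \<le> (min 1 \<bar>s k\<bar>)\<^sup>2" using \<mu>0 by (intro power_mono) auto
        then have "c0 * (\<mu> * \<bar>\<Delta> k\<bar> / 2)\<^sup>2 \<le> \<eta> k" unfolding \<eta>_def using c0 by (intro mult_left_mono) auto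
        then show ?thesis by (simp add: power_mult_distrib power_divide)
      qed
      have "\<delta> / 8 \<le> 2 * real m / real n" using m n3 by (simp add: field_simps)
      with pw have "\<delta> / 8 \<le> (\<Sum>k<m. (\<Delta> k)\<^sup>2)" by (simp add: \<Delta>_def)
      then have "c0 / 4 * \<mu>\<^sup>2 * (\<delta> / 8) \<le> c0 / 4 * \<mu>\<^sup>2 * (\<Sum>k<m. (\<Delta> k)\<^sup>2)" using c0 by (intro mult_left_mono) auto
      also have "\<dots> = (\<Sum>k<m. c0 / 4 * \<mu>\<^sup>2 * (\<Delta> k)\<^sup>2)" by (simp add: sum_distrib_left)
      also have "\<dots> \<le> (\<Sum>k<m. \<eta> k)" using lo by (intro sum_mono) auto
      finally have sum: "2 * c * \<mu>\<^sup>2 \<le> (\<Sum>k<m. \<eta> k)" by (simp add: c_def mult_ac)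
      have "(\<Prod>k<m. 1 - \<eta> k) \<le> (\<Prod>k<m. exp (- \<eta> k))"
      proof (intro prod_mono conjI)
        fix k assume "k \<in> {..<m}"
        show "0 \<le> 1 - \<eta> k" using \<eta>1[of k] by simp
        show "1 - \<eta> k \<le> exp (- \<eta> k)" using exp_ge_add_one_self[of "- \<eta> k"] by simp
      qed
      also have "\<dots> = exp (- (\<Sum>k<m. \<eta> k))" by (simp add: exp_sum sum_negf[symmetric])
      also have "\<dots> \<le> exp (- (2 * c * \<mu>\<^sup>2))" using sum by simp
      finally show ?thesis by (simp add: \<mu>_def)
    qed
    finally have P: "(\<Sum>\<pi>\<in>Perms n. \<Prod>k<m. f k (\<pi> (p (2*k))) (\<pi> (p (2*k+1)))) \<le> fact n * exp (- (2 * c * (min \<bar>t\<bar> T)\<^sup>2))"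
      by simp
    have feq: "f k (\<pi> (p (2*k))) (\<pi> (p (2*k+1))) = 1 - exp (- 2) * (sin (t * swap_gain w v p k \<pi>))\<^sup>2" for k \<pi>
      by (simp add: f_def s_def swap_gain_def \<Delta>_def \<kappa>_def mult.assoc)
    have "norm (\<Sum>\<pi>\<in>Perms n. exp (Complex a t * of_real (perm_sum n w v \<pi>)))
      \<le> sqrt (\<Sum>\<pi>\<in>Perms n. exp (2 * a * perm_sum n w v \<pi>)) *
        sqrt (\<Sum>\<pi>\<in>Perms n. \<Prod>k<m. 1 - exp (- 2) * (sin (t * swap_gain w v p k \<pi>))\<^sup>2)"
      by (rule norm_tilted_exp_sum_le[OF p small])
    also have "\<dots> \<le> sqrt (\<Sum>\<pi>\<in>Perms n. exp (2 * a * perm_sum n w v \<pi>)) * sqrt (fact n * exp (- (2 * c * (min \<bar>t\<bar> T)\<^sup>2)))"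
      using P unfolding feq by (intro mult_left_mono real_sqrt_le_mono real_sqrt_ge_zero sum_nonneg) auto
    also have "sqrt (fact n * exp (- (2 * c * (min \<bar>t\<bar> T)\<^sup>2))) = sqrt (fact n) * exp (- c * (min \<bar>t\<bar> T)\<^sup>2)"
    proof -
      have "exp (- (2 * c * (min \<bar>t\<bar> T)\<^sup>2)) = (exp (- c * (min \<bar>t\<bar> T)\<^sup>2))\<^sup>2"
        by (simp add: exp_double[symmetric] mult.assoc)
      then show ?thesis by (simp add: real_sqrt_mult)
    qed
    finally show "norm (\<Sum>\<pi>\<in>Perms n. exp (Complex a t * of_real (perm_sum n w v \<pi>)))
      \<le> sqrt (fact n) * sqrt (\<Sum>\<pi>\<in>Perms n. exp (2 * a * perm_sum n w v \<pi>)) *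
        exp (- c * (min \<bar>t\<bar> (A * sqrt (ln (real n))))\<^sup>2)" by (simp add: T_def mult_ac)
  qed
qed

section \<open>Local bounds\<close>

text \<open>Majorises the window by the squared modulus of the Dirichlet kernel, so that only the integer
  frequencies \<open>j - k\<close> occur.\<close>

lemma card_window_le:
  fixes S :: "(nat \<Rightarrow> nat) \<Rightarrow> real" and a L :: real
  assumes n: "n \<ge> 1"
  shows "real (card {\<pi>\<in>Perms n. \<bar>S \<pi> - L\<bar> \<le> 1 / real n}) * (exp (- \<bar>a\<bar> / real n) * ((real n)\<^sup>2 / 4))
    \<le> exp (- a * L) * (\<Sum>j<n. \<Sum>k<n. norm (\<Sum>\<pi>\<in>Perms n. exp (Complex a (real j - real k) * of_real (S \<pi>))))"
proof -
  define dir where "dir x = (\<Sum>j<n. cis (real j * x))" for x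
  define W where "W = {\<pi>\<in>Perms n. \<bar>S \<pi> - L\<bar> \<le> 1 / real n}"
  have n0: "real n > 0" using n by simp
  \<comment> \<open>For \<open>j < n\<close> the angle \<open>j * x\<close> is at most
    \<open>1 \<le> pi / 3\<close> in absolute value, so every summand has real part at least
    \<open>1 / 2\<close>.\<close>
  have dir_lo: "(real n)\<^sup>2 / 4 \<le> (norm (dir x))\<^sup>2" if x: "\<bar>x\<bar> \<le> 1 / real n" for x
  proof -
    have "1 / 2 \<le> cos (real j * x)" if j: "j < n" for j
    proof -
      have "\<bar>real j * x\<bar> \<le> real n * (1 / real n)" unfolding abs_mult using j x by (intro mult_mono) auto
      then have b: "\<bar>real j * x\<bar> \<le> pi / 3" using n0 pi_gt3 by simp
      have "cos (pi / 3) \<le> cos \<bar>real j * x\<bar>" using b by (intro cos_monotone_0_pi_le) auto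
      then show ?thesis by (simp add: cos_60)
    qed
    then have "(\<Sum>j<n. 1 / 2) \<le> (\<Sum>j<n. cos (real j * x))" by (intro sum_mono) auto
    also have "\<dots> = Re (dir x)" by (simp add: dir_def)
    also have "\<dots> \<le> norm (dir x)" by (rule complex_Re_le_cmod)
    finally have "real n / 2 \<le> norm (dir x)" by simp
    then have "(real n / 2)\<^sup>2 \<le> (norm (dir x))\<^sup>2" by (intro power_mono) auto
    then show ?thesis by (simp add: power_divide)
  qed
  have dir_sq: "of_real (exp (a * x) * (norm (dir x))\<^sup>2) = (\<Sum>j<n. \<Sum>k<n. exp (Complex a (real j - real k) * of_real x))" for x
  proof -
    have "of_real ((norm (dir x))\<^sup>2) = dir x * cnj (dir x)" by (simp only: complex_norm_square)
    also have "\<dots> = (\<Sum>j<n. \<Sum>k<n. cis (real j * x) * cis (- (real k * x)))"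
      by (simp add: dir_def sum_product cis_cnj)
    also have "of_real (exp (a * x)) * \<dots> = (\<Sum>j<n. \<Sum>k<n. exp (Complex a (real j - real k) * of_real x))"
      unfolding sum_distrib_left
    proof (intro sum.cong refl)
      fix j k
      have "Complex a (real j - real k) * of_real x = Complex (a * x) (real j * x - real k * x)"
        by (simp add: complex_eq_iff algebra_simps)
      then show "of_real (exp (a * x)) * (cis (real j * x) * cis (- (real k * x))) = exp (Complex a (real j - real k) * of_real x)"
        by (simp add: exp_eq_polar cis_mult)
    qed
    finally show ?thesis by simp
  qed
  have "real (card W) * (exp (- \<bar>a\<bar> / real n) * ((real n)\<^sup>2 / 4)) = (\<Sum>\<pi>\<in>W. exp (- \<bar>a\<bar> / real n) * ((real n)\<^sup>2 / 4))"
    by simp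
  also have "\<dots> \<le> (\<Sum>\<pi>\<in>W. exp (a * (S \<pi> - L)) * (norm (dir (S \<pi> - L)))\<^sup>2)"
  proof (intro sum_mono mult_mono)
    fix \<pi> assume "\<pi> \<in> W"
    then have x: "\<bar>S \<pi> - L\<bar> \<le> 1 / real n" by (simp add: W_def)
    show "(real n)\<^sup>2 / 4 \<le> (norm (dir (S \<pi> - L)))\<^sup>2" by (rule dir_lo[OF x])
    have "\<bar>a * (S \<pi> - L)\<bar> \<le> \<bar>a\<bar> * (1 / real n)" unfolding abs_mult using x by (intro mult_left_mono) auto
    then show "exp (- \<bar>a\<bar> / real n) \<le> exp (a * (S \<pi> - L))" by simp
  qed auto
  also have "\<dots> \<le> (\<Sum>\<pi>\<in>Perms n. exp (a * (S \<pi> - L)) * (norm (dir (S \<pi> - L)))\<^sup>2)"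
    by (intro sum_mono2) (auto simp: W_def)
  also have "\<dots> \<le> norm (of_real (\<Sum>\<pi>\<in>Perms n. exp (a * (S \<pi> - L)) * (norm (dir (S \<pi> - L)))\<^sup>2) :: complex)"
    by (simp only: norm_of_real abs_ge_self)
  also have "of_real (\<Sum>\<pi>\<in>Perms n. exp (a * (S \<pi> - L)) * (norm (dir (S \<pi> - L)))\<^sup>2)
    = (\<Sum>\<pi>\<in>Perms n. \<Sum>j<n. \<Sum>k<n. exp (Complex a (real j - real k) * of_real (S \<pi> - L)))"
    by (simp only: of_real_sum dir_sq)
  also have "\<dots> = (\<Sum>j<n. \<Sum>\<pi>\<in>Perms n. \<Sum>k<n. exp (Complex a (real j - real k) * of_real (S \<pi> - L)))"
    by (rule sum.swap)
  also have "\<dots> = (\<Sum>j<n. \<Sum>k<n. \<Sum>\<pi>\<in>Perms n. exp (Complex a (real j - real k) * of_real (S \<pi> - L)))"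
    by (intro sum.cong refl sum.swap)
  also have "norm \<dots> \<le> (\<Sum>j<n. \<Sum>k<n. norm (\<Sum>\<pi>\<in>Perms n. exp (Complex a (real j - real k) * of_real (S \<pi> - L))))"
    by (intro sum_norm_le order.refl)
  also have "\<dots> = (\<Sum>j<n. \<Sum>k<n. exp (- a * L) * norm (\<Sum>\<pi>\<in>Perms n. exp (Complex a (real j - real k) * of_real (S \<pi>))))"
  proof (intro sum.cong refl)
    fix j k
    let ?z = "Complex a (real j - real k)"
    have "(\<Sum>\<pi>\<in>Perms n. exp (?z * of_real (S \<pi> - L))) = (\<Sum>\<pi>\<in>Perms n. exp (- ?z * of_real L) * exp (?z * of_real (S \<pi>)))"
      by (intro sum.cong refl) (simp add: exp_add[symmetric] right_diff_distrib)
    also have "\<dots> = exp (- ?z * of_real L) * (\<Sum>\<pi>\<in>Perms n. exp (?z * of_real (S \<pi>)))" by (rule sum_distrib_left[symmetric])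
    finally have "norm (\<Sum>\<pi>\<in>Perms n. exp (?z * of_real (S \<pi> - L))) = norm (exp (- ?z * of_real L)) * norm (\<Sum>\<pi>\<in>Perms n. exp (?z * of_real (S \<pi>)))"
      by (simp only: norm_mult)
    moreover have "norm (exp (- ?z * of_real L)) = exp (- a * L)" by simp
    ultimately show "norm (\<Sum>\<pi>\<in>Perms n. exp (?z * of_real (S \<pi> - L))) = exp (- a * L) * norm (\<Sum>\<pi>\<in>Perms n. exp (?z * of_real (S \<pi>)))"
      by simp
  qed
  also have "\<dots> = exp (- a * L) * (\<Sum>j<n. \<Sum>k<n. norm (\<Sum>\<pi>\<in>Perms n. exp (Complex a (real j - real k) * of_real (S \<pi>))))"
    by (simp only: sum_distrib_left)
  finally show ?thesis by (simp add: W_def)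
qed

text \<open>Two geometric series, one on each side of \<open>j\<close>.\<close>

lemma sum_exp_neg_dist_le:
  fixes c :: real
  assumes "0 < c"
  shows "(\<Sum>k<n. exp (- c * \<bar>real j - real k\<bar>)) \<le> 2 / (1 - exp (- c))"
proof -
  define q where "q = exp (- c)"
  have q: "0 < q" "q < 1" using assms by (auto simp: q_def)
  have geo: "(\<Sum>i\<in>X. q ^ i) \<le> 1 / (1 - q)" if "finite X" for X
  proof -
    have "(\<Sum>i\<in>X. q ^ i) \<le> (\<Sum>i. q ^ i)" using q that by (intro sum_le_suminf summable_geometric) auto
    then show ?thesis using q by (simp add: suminf_geometric)
  qed
  have e: "exp (- c * \<bar>real j - real k\<bar>) = q ^ (if k \<le> j then j - k else k - j)" for k
    unfolding q_def exp_of_nat_mult[symmetric] by (auto simp: of_nat_diff)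
  have "(\<Sum>k<n. exp (- c * \<bar>real j - real k\<bar>)) = (\<Sum>k\<in>{..<n}. q ^ (if k \<le> j then j - k else k - j))"
    by (simp only: e)
  also have "\<dots> = (\<Sum>k\<in>{..<n} \<inter> {..j}. q ^ (j - k)) + (\<Sum>k\<in>{..<n} - {..j}. q ^ (k - j))"
    by (subst sum.Int_Diff[of _ _ "{..j}"]) (auto intro!: arg_cong2[where f = "(+)"] sum.cong)
  also have "(\<Sum>k\<in>{..<n} \<inter> {..j}. q ^ (j - k)) = (\<Sum>i\<in>(\<lambda>k. j - k) ` ({..<n} \<inter> {..j}). q ^ i)"
    by (subst sum.reindex) (auto simp: inj_on_def)
  also have "(\<Sum>k\<in>{..<n} - {..j}. q ^ (k - j)) = (\<Sum>i\<in>(\<lambda>k. k - j) ` ({..<n} - {..j}). q ^ i)"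
    by (subst sum.reindex) (auto simp: inj_on_def)
  also have "(\<Sum>i\<in>(\<lambda>k. j - k) ` ({..<n} \<inter> {..j}). q ^ i) + (\<Sum>i\<in>(\<lambda>k. k - j) ` ({..<n} - {..j}). q ^ i) \<le> 1 / (1 - q) + 1 / (1 - q)"
    by (intro add_mono geo) auto
  finally show ?thesis by (simp add: q_def)
qed

text \<open>Below the cutoff an integer frequency \<open>r \<ge> 0\<close> satisfies
  \<open>r \<le> r^2\<close>, which leaves a geometric series; on the plateau
  \<open>c * A^2 \<ge> 1\<close> gives at most \<open>1 / n\<close> per pair \<open>(j, k)\<close>.
  So the \<open>n^2\<close> terms add up to order \<open>n\<close> only.\<close>

lemma sum_decay_le:
  fixes c A :: real
  assumes "0 < c" "1 \<le> c * A\<^sup>2" "n \<ge> 1"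
  shows "(\<Sum>j<n. \<Sum>k<n. exp (- c * (min \<bar>real j - real k\<bar> (A * sqrt (ln (real n))))\<^sup>2))
    \<le> real n * (2 / (1 - exp (- c)) + 1)"
proof -
  have ln0: "0 \<le> ln (real n)" using assms(3) by simp
  have le: "exp (- c * (min \<bar>real j - real k\<bar> (A * sqrt (ln (real n))))\<^sup>2) \<le> exp (- c * \<bar>real j - real k\<bar>) + 1 / real n" for j k
  proof (cases "\<bar>real j - real k\<bar> \<le> A * sqrt (ln (real n))")
    case True
    have "\<bar>real j - real k\<bar> \<le> (real j - real k)\<^sup>2"
    proof -
      have "\<bar>int j - int k\<bar> \<le> (int j - int k)\<^sup>2"
      proof (cases "j = k")
        case False
        then have "1 \<le> \<bar>int j - int k\<bar>" by linarith
        from self_le_power[OF this, of 2] show ?thesis by simp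
      qed simp
      then have "real_of_int \<bar>int j - int k\<bar> \<le> real_of_int ((int j - int k)\<^sup>2)" by (simp only: of_int_le_iff)
      then show ?thesis by simp
    qed
    then have "exp (- c * (real j - real k)\<^sup>2) \<le> exp (- c * \<bar>real j - real k\<bar>)" using assms(1) by simp
    moreover have "0 \<le> 1 / real n" by simp
    moreover have sq: "(min \<bar>real j - real k\<bar> (A * sqrt (ln (real n))))\<^sup>2 = (real j - real k)\<^sup>2"
      using True by (simp add: min_absorb1)
    ultimately show ?thesis unfolding sq by linarith
  next
    case False
    have "1 * ln (real n) \<le> c * A\<^sup>2 * ln (real n)" using assms(2) ln0 by (intro mult_right_mono)
    then have "exp (- (c * A\<^sup>2 * ln (real n))) \<le> exp (- ln (real n))" by simp
    also have "\<dots> = 1 / real n" using assms(3) by (simp add: exp_minus inverse_eq_divide)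
    finally have "exp (- (c * A\<^sup>2 * ln (real n))) \<le> 1 / real n" .
    moreover have "(min \<bar>real j - real k\<bar> (A * sqrt (ln (real n))))\<^sup>2 = A\<^sup>2 * ln (real n)"
      using False ln0 by (simp add: min_absorb2 power_mult_distrib)
    ultimately show ?thesis by (simp add: mult.assoc add_increasing)
  qed
  have "(\<Sum>j<n. \<Sum>k<n. exp (- c * (min \<bar>real j - real k\<bar> (A * sqrt (ln (real n))))\<^sup>2))
    \<le> (\<Sum>j<n. \<Sum>k<n. exp (- c * \<bar>real j - real k\<bar>) + 1 / real n)" by (intro sum_mono le)
  also have "\<dots> = (\<Sum>j<n. (\<Sum>k<n. exp (- c * \<bar>real j - real k\<bar>)) + 1)"
    using assms(3) by (simp add: sum.distrib)
  also have "\<dots> \<le> (\<Sum>j<n. 2 / (1 - exp (- c)) + 1)" by (intro sum_mono add_right_mono sum_exp_neg_dist_le assms)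
  finally show ?thesis by simp
qed

lemma prob_random_perm:
  "measure_pmf.prob (random_perm n) {\<pi>. P \<pi>} = real (card {\<pi>\<in>Perms n. P \<pi>}) / fact n"
proof -
  have "Perms n \<noteq> {}" using card_Perms[of n] by (metis card.empty fact_nonzero)
  moreover have "random_perm n = pmf_of_set (Perms n)" by (simp add: random_perm_def Perms_def)
  ultimately have "measure_pmf.prob (random_perm n) {\<pi>. P \<pi>} = real (card (Perms n \<inter> {\<pi>. P \<pi>})) / real (card (Perms n))"
    by (simp add: measure_pmf_of_set)
  also have "Perms n \<inter> {\<pi>. P \<pi>} = {\<pi>\<in>Perms n. P \<pi>}" by auto
  finally show ?thesis by (simp add: card_Perms)
qed

text \<open>Each permutation in the window weighs at least \<open>n^2 / 4\<close> in the Dirichlet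
  majorant, against a frequency sum of order \<open>n\<close>; this produces \<open>1 / n\<close>.
  The factor \<open>exp (|a| / n)\<close> is the variation of the tilt across the window. The tilt
  is left free so that \<open>a = 0\<close> serves (a) and \<open>a\<close> proportional to
  \<open>L\<close> serves (b).\<close>

lemma tilted_local_bound:
  fixes d :: nat and \<delta> b B :: real
  assumes "d \<ge> 2" "\<delta> > 0" "b \<noteq> 0" "B > 0"
  shows "\<exists>A\<^sub>0\<ge>1. \<exists>N\<ge>2. \<exists>K>0. \<forall>A\<ge>A\<^sub>0. \<forall>n\<ge>N. \<forall>w I v a L. spread_weights A n w \<longrightarrow> I \<subseteq> {1..n} \<longrightarrow>
    real (card I) \<ge> \<delta> * real n \<longrightarrow> poly_on d b B n I v \<longrightarrow>
    (\<forall>x\<in>{1..n}. \<forall>y\<in>{1..n}. \<bar>a\<bar> * \<bar>v x - v y\<bar> \<le> 2 * sqrt (ln (real n))) \<longrightarrow>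
    measure_pmf.prob (random_perm n) {\<pi>. \<bar>perm_sum n w v \<pi> - L\<bar> \<le> 1 / real n}
      \<le> K / real n * exp (\<bar>a\<bar> / real n - a * L) *
         sqrt ((\<Sum>\<pi>\<in>Perms n. exp (2 * a * perm_sum n w v \<pi>)) / fact n)"
proof -
  define decay where "decay c A n \<longleftrightarrow> (\<forall>w I v a t. spread_weights A n w \<longrightarrow> I \<subseteq> {1..n} \<longrightarrow>
    real (card I) \<ge> \<delta> * real n \<longrightarrow> poly_on d b B n I v \<longrightarrow>
    (\<forall>x\<in>{1..n}. \<forall>y\<in>{1..n}. \<bar>a\<bar> * \<bar>v x - v y\<bar> \<le> 2 * sqrt (ln (real n))) \<longrightarrow> \<bar>t\<bar> \<le> real n \<longrightarrow>
    norm (\<Sum>\<pi>\<in>Perms n. exp (Complex a t * of_real (perm_sum n w v \<pi>)))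
      \<le> sqrt (fact n) * sqrt (\<Sum>\<pi>\<in>Perms n. exp (2 * a * perm_sum n w v \<pi>)) *
        exp (- c * (min \<bar>t\<bar> (A * sqrt (ln (real n))))\<^sup>2))" for c A n
  have "\<exists>c>0. \<exists>A\<^sub>1\<ge>1. \<exists>N. \<forall>A\<ge>A\<^sub>1. \<forall>n\<ge>N. decay c A n"
    unfolding decay_def by (rule tilted_exp_sum_decay[OF assms])
  then obtain c A1 N where c: "0 < c" and A1: "1 \<le> A1" and dec: "\<And>A n. A \<ge> A1 \<Longrightarrow> n \<ge> N \<Longrightarrow> decay c A n"
    by blast
  \<comment> \<open>The second term ensures \<open>c * A^2 \<ge> 1\<close>, as
    \<open>sum_decay_le\<close> requires.\<close>
  define A0 where "A0 = max A1 (1 / sqrt c)"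
  define K where "K = 4 * (2 / (1 - exp (- c)) + 1)"
  have K: "0 < K" using c by (simp add: K_def add_pos_pos)
  show ?thesis
  proof (rule exI[of _ A0], rule conjI, simp add: A0_def A1 max.coboundedI1, rule exI[of _ "max 2 N"], rule conjI, simp,
      rule exI[of _ K], rule conjI[OF K], intro allI impI)
    fix A n w I v a L
    assume A: "A0 \<le> A" and n: "max 2 N \<le> n" and h: "spread_weights A n w" "I \<subseteq> {1..n}" "\<delta> * real n \<le> real (card I)"
      "poly_on d b B n I v" "\<forall>x\<in>{1..n}. \<forall>y\<in>{1..n}. \<bar>a\<bar> * \<bar>v x - v y\<bar> \<le> 2 * sqrt (ln (real n))"
    have n1: "1 \<le> n" "N \<le> n" using n by auto
    have n0: "0 < real n" using n1 by simp
    have cA: "1 \<le> c * A\<^sup>2"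
    proof -
      have "(1 / sqrt c)\<^sup>2 \<le> A\<^sup>2" using A c by (intro power_mono) (auto simp: A0_def)
      then have "1 / c \<le> A\<^sup>2" using c by (simp add: power_divide)
      then show ?thesis using c by (simp add: field_simps)
    qed
    define M where "M = (\<Sum>\<pi>\<in>Perms n. exp (2 * a * perm_sum n w v \<pi>))"
    have M0: "0 \<le> M" unfolding M_def by (intro sum_nonneg) auto
    define p where "p = real (card {\<pi>\<in>Perms n. \<bar>perm_sum n w v \<pi> - L\<bar> \<le> 1 / real n})"
    have "p * (exp (- \<bar>a\<bar> / real n) * ((real n)\<^sup>2 / 4))
      \<le> exp (- a * L) * (\<Sum>j<n. \<Sum>k<n. norm (\<Sum>\<pi>\<in>Perms n. exp (Complex a (real j - real k) * of_real (perm_sum n w v \<pi>))))"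
      unfolding p_def by (rule card_window_le[OF n1(1)])
    also have "\<dots> \<le> exp (- a * L) * (\<Sum>j<n. \<Sum>k<n. sqrt (fact n) * sqrt M * exp (- c * (min \<bar>real j - real k\<bar> (A * sqrt (ln (real n))))\<^sup>2))"
    proof (intro mult_left_mono sum_mono)
      fix j k assume "j \<in> {..<n}" "k \<in> {..<n}"
      then have t: "\<bar>real j - real k\<bar> \<le> real n" by auto
      have "decay c A n" using dec[of A n] A n1 by (simp add: A0_def)
      from this[unfolded decay_def, rule_format, OF h(1-4) _ t] h(5)
      show "norm (\<Sum>\<pi>\<in>Perms n. exp (Complex a (real j - real k) * of_real (perm_sum n w v \<pi>)))
        \<le> sqrt (fact n) * sqrt M * exp (- c * (min \<bar>real j - real k\<bar> (A * sqrt (ln (real n))))\<^sup>2)"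
        unfolding M_def by blast
    qed auto
    also have "\<dots> = exp (- a * L) * (sqrt (fact n) * sqrt M) * (\<Sum>j<n. \<Sum>k<n. exp (- c * (min \<bar>real j - real k\<bar> (A * sqrt (ln (real n))))\<^sup>2))"
      by (simp only: sum_distrib_left mult.assoc)
    also have "\<dots> \<le> exp (- a * L) * (sqrt (fact n) * sqrt M) * (real n * (2 / (1 - exp (- c)) + 1))"
      using sum_decay_le[OF c cA n1(1)] M0 by (intro mult_left_mono) auto
    also have "\<dots> = exp (- a * L) * (sqrt (fact n) * sqrt M) * (real n * (K / 4))" by (simp add: K_def)
    finally have "p * (exp (- \<bar>a\<bar> / real n) * ((real n)\<^sup>2 / 4)) \<le> exp (- a * L) * (sqrt (fact n) * sqrt M) * (real n * (K / 4))" .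
    then have "p * (exp (- \<bar>a\<bar> / real n) * ((real n)\<^sup>2 / 4)) * (4 * exp (\<bar>a\<bar> / real n) / (real n)\<^sup>2)
      \<le> exp (- a * L) * (sqrt (fact n) * sqrt M) * (real n * (K / 4)) * (4 * exp (\<bar>a\<bar> / real n) / (real n)\<^sup>2)"
      by (intro mult_right_mono) auto
    moreover have "p * (exp (- \<bar>a\<bar> / real n) * ((real n)\<^sup>2 / 4)) * (4 * exp (\<bar>a\<bar> / real n) / (real n)\<^sup>2)
      = p * (exp (- \<bar>a\<bar> / real n) * exp (\<bar>a\<bar> / real n))" using n0 by (simp add: field_simps)
    moreover have "exp (- \<bar>a\<bar> / real n) * exp (\<bar>a\<bar> / real n) = 1" by (simp add: exp_add[symmetric])
    moreover have "exp (- a * L) * (sqrt (fact n) * sqrt M) * (real n * (K / 4)) * (4 * exp (\<bar>a\<bar> / real n) / (real n)\<^sup>2)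
      = K / real n * (exp (- a * L) * exp (\<bar>a\<bar> / real n)) * (sqrt (fact n) * sqrt M)"
      using n0 by (simp add: field_simps power2_eq_square)
    moreover have "exp (- a * L) * exp (\<bar>a\<bar> / real n) = exp (\<bar>a\<bar> / real n - a * L)" by (simp add: exp_add[symmetric])
    ultimately have "p \<le> K / real n * exp (\<bar>a\<bar> / real n - a * L) * (sqrt (fact n) * sqrt M)" by simp
    then have "p / fact n \<le> K / real n * exp (\<bar>a\<bar> / real n - a * L) * (sqrt (fact n) * sqrt M) / fact n"
      by (intro divide_right_mono) auto
    also have "\<dots> = K / real n * exp (\<bar>a\<bar> / real n - a * L) * (sqrt (fact n) * sqrt M / fact n)" by simp
    also have "sqrt (fact n) * sqrt M / fact n = sqrt (M / fact n)"
    proof -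
      define r where "r = sqrt (fact n :: real)"
      have r: "r \<noteq> 0" "fact n = r * r" by (simp_all add: r_def)
      have "sqrt (fact n) * sqrt M / fact n = r * sqrt M / (r * r)" using r(2) by (simp add: r_def)
      also have "\<dots> = sqrt M / r" using r(1) by simp
      finally show ?thesis by (simp add: r_def real_sqrt_divide)
    qed
    finally show "measure_pmf.prob (random_perm n) {\<pi>. \<bar>perm_sum n w v \<pi> - L\<bar> \<le> 1 / real n}
      \<le> K / real n * exp (\<bar>a\<bar> / real n - a * L) * sqrt ((\<Sum>\<pi>\<in>Perms n. exp (2 * a * perm_sum n w v \<pi>)) / fact n)"
      by (simp add: prob_random_perm p_def M_def)
  qed
qed

section \<open>The Gaussian factor and the final assembly\<close>

text \<open>Crude, but meant for the finitely many small \<open>n\<close>, where it empties the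
  window once \<open>|L|\<close> is large.\<close>

lemma perm_sum_abs_le:
  assumes w: "(\<Sum>i=1..n. (w i)\<^sup>2) = 1" and v: "\<And>i. i \<in> {1..n} \<Longrightarrow> \<bar>v i\<bar> \<le> C" and \<pi>: "\<pi> \<in> Perms n"
  shows "\<bar>perm_sum n w v \<pi>\<bar> \<le> real n * C"
proof -
  have "\<bar>perm_sum n w v \<pi>\<bar> \<le> (\<Sum>i=1..n. \<bar>w i * v (\<pi> i)\<bar>)" unfolding perm_sum_def by (rule sum_abs)
  also have "\<dots> \<le> (\<Sum>i=1..n. C)"
  proof (rule sum_mono)
    fix i assume i: "i \<in> {1..n}"
    have "(w i)\<^sup>2 \<le> (\<Sum>i=1..n. (w i)\<^sup>2)" using i by (intro member_le_sum) auto
    then have "\<bar>w i\<bar> \<le> 1" using w by (simp add: abs_square_le_1)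
    moreover have "\<bar>v (\<pi> i)\<bar> \<le> C" using v Perms_in[OF \<pi> i] by blast
    ultimately have "\<bar>w i\<bar> * \<bar>v (\<pi> i)\<bar> \<le> 1 * C" by (intro mult_mono) auto
    then show "\<bar>w i * v (\<pi> i)\<bar> \<le> C" by (simp add: abs_mult)
  qed
  finally show ?thesis by simp
qed

text \<open>The variation of the tilt across the window is linear in \<open>L\<close>; a quarter of
  the gain \<open>e * L^2\<close> and a constant absorb it.\<close>

lemma tilt_error_le:
  fixes e L :: real
  assumes "0 \<le> e" "n \<ge> 1"
  shows "\<bar>e * L\<bar> / real n \<le> e * L\<^sup>2 / 4 + e"
proof -
  have "0 \<le> (\<bar>L\<bar> / 2 - 1)\<^sup>2" by simp
  then have "\<bar>L\<bar> \<le> L\<^sup>2 / 4 + 1" by (simp add: power2_eq_square algebra_simps)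
  then have "e * \<bar>L\<bar> \<le> e * (L\<^sup>2 / 4 + 1)" using assms by (intro mult_left_mono)
  moreover have "\<bar>e * L\<bar> / real n \<le> \<bar>e * L\<bar> / 1" using assms by (intro divide_left_mono) auto
  ultimately show ?thesis using assms by (simp add: abs_mult algebra_simps)
qed

text \<open>Exponential Markov inequality with tilt \<open>e * L\<close>. It leaves the exponent
  \<open>- e * L^2 / 2\<close>, up to a constant; as \<open>e * L^2 / 4 \<ge> ln n\<close>, one half
  of it pays for \<open>1 / n\<close> and the other half is the Gaussian factor.\<close>

lemma gaussian_tail:
  fixes w v :: "nat \<Rightarrow> real" and e C L :: real
  assumes n: "n \<ge> 1" and w: "(\<Sum>i=1..n. w i) = 0" "(\<Sum>i=1..n. (w i)\<^sup>2) = 1"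
    and v: "\<And>i. i \<in> {1..n} \<Longrightarrow> \<bar>v i\<bar> \<le> C" and e: "0 < e" "8 * C\<^sup>2 * e = 1"
    and L: "4 * ln (real n) \<le> e * L\<^sup>2"
  shows "measure_pmf.prob (random_perm n) {\<pi>. \<bar>perm_sum n w v \<pi> - L\<bar> \<le> 1 / real n}
    \<le> exp e / real n * exp (- (e / 4) * L\<^sup>2)"
proof -
  define S where "S = perm_sum n w v"
  define a where "a = e * L"
  define W where "W = {\<pi>\<in>Perms n. \<bar>S \<pi> - L\<bar> \<le> 1 / real n}"
  have lo: "exp (a * L - \<bar>a\<bar> / real n) \<le> exp (a * S \<pi>)" if "\<pi> \<in> W" for \<pi>
  proof -
    have "\<bar>a * (S \<pi> - L)\<bar> \<le> \<bar>a\<bar> * (1 / real n)"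
      unfolding abs_mult using that by (intro mult_left_mono) (auto simp: W_def)
    then show ?thesis by (simp add: right_diff_distrib)
  qed
  have "real (card W) * exp (a * L - \<bar>a\<bar> / real n) = (\<Sum>\<pi>\<in>W. exp (a * L - \<bar>a\<bar> / real n))" by simp
  also have "\<dots> \<le> (\<Sum>\<pi>\<in>W. exp (a * S \<pi>))" by (intro sum_mono lo)
  also have "\<dots> \<le> (\<Sum>\<pi>\<in>Perms n. exp (a * S \<pi>))" by (intro sum_mono2) (auto simp: W_def)
  also have "\<dots> \<le> fact n * exp (2 * C\<^sup>2 * a\<^sup>2)" unfolding S_def by (rule subgaussian[OF n w v])
  finally have "real (card W) * exp (a * L - \<bar>a\<bar> / real n) \<le> fact n * exp (2 * C\<^sup>2 * a\<^sup>2)" .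
  then have "real (card W) / fact n \<le> exp (2 * C\<^sup>2 * a\<^sup>2) / exp (a * L - \<bar>a\<bar> / real n)"
    by (simp add: field_simps)
  also have "\<dots> = exp (\<bar>a\<bar> / real n - a * L + 2 * C\<^sup>2 * a\<^sup>2)"
    by (simp add: exp_diff[symmetric] algebra_simps)
  also have "\<dots> \<le> exp (e - e / 2 * L\<^sup>2)"
  proof -
    have "2 * C\<^sup>2 * a\<^sup>2 = (8 * C\<^sup>2 * e) * (e * L\<^sup>2 / 4)" by (simp add: a_def power2_eq_square)
    then have q: "2 * C\<^sup>2 * a\<^sup>2 = e * L\<^sup>2 / 4" using e by simp
    have "\<bar>a\<bar> / real n \<le> e * L\<^sup>2 / 4 + e" unfolding a_def by (rule tilt_error_le) (use e n in auto)
    moreover have "a * L = e * L\<^sup>2" by (simp add: a_def power2_eq_square)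
    ultimately have "\<bar>a\<bar> / real n - a * L + 2 * C\<^sup>2 * a\<^sup>2 \<le> e - e * L\<^sup>2 / 2" using q by linarith
    then show ?thesis by simp
  qed
  also have "\<dots> \<le> exp (e - ln (real n) - e / 4 * L\<^sup>2)" using L by simp
  also have "e - ln (real n) - e / 4 * L\<^sup>2 = e + - (e / 4) * L\<^sup>2 - ln (real n)" by simp
  also have "exp \<dots> = exp e * exp (- (e / 4) * L\<^sup>2) / real n"
    using n by (simp only: exp_diff exp_add) simp
  also have "\<dots> = exp e / real n * exp (- (e / 4) * L\<^sup>2)" by simp
  finally show ?thesis by (simp add: prob_random_perm W_def S_def)
qed

theorem theorem2p9:
  fixes d :: nat and \<delta> b B :: real
  assumes "d \<ge> 2" and "\<delta> > 0" and "b \<noteq> 0" and "B > 0"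
  shows "\<exists>A\<^sub>0 > 0. \<forall>A \<ge> A\<^sub>0.
    (\<exists>K :: real. \<forall>(n :: nat) \<ge> 2. \<forall>(w :: nat \<Rightarrow> real) (I :: nat set) (v :: nat \<Rightarrow> real).
       spread_weights A n w \<and> I \<subseteq> {1..n} \<and> real (card I) \<ge> \<delta> * real n \<and>
       poly_on d b B n I v \<longrightarrow>
       (\<forall>L :: real. measure_pmf.prob (random_perm n) {\<pi>. \<bar>perm_sum n w v \<pi> - L\<bar> \<le> 1 / real n}
          \<le> K / real n)) \<and>
    (\<forall>B' :: real. B' > 0 \<longrightarrow>
      (\<exists>(K' :: real) > 0. \<exists>(c :: real) > 0.
       \<forall>(n :: nat) \<ge> 2. \<forall>(w :: nat \<Rightarrow> real) (I :: nat set) (v :: nat \<Rightarrow> real).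
       spread_weights A n w \<and> I \<subseteq> {1..n} \<and> real (card I) \<ge> \<delta> * real n \<and>
       poly_on d b B n I v \<and> (\<forall>i\<in>{1..n}. \<bar>v i\<bar> \<le> B') \<longrightarrow>
       (\<forall>L :: real. measure_pmf.prob (random_perm n) {\<pi>. \<bar>perm_sum n w v \<pi> - L\<bar> \<le> 1 / real n}
          \<le> K' / real n * exp (- c * L\<^sup>2))))"
proof -
  define tilted where "tilted K A n \<longleftrightarrow> (\<forall>w I v a L. spread_weights A n w \<longrightarrow> I \<subseteq> {1..n} \<longrightarrow>
    real (card I) \<ge> \<delta> * real n \<longrightarrow> poly_on d b B n I v \<longrightarrow>
    (\<forall>x\<in>{1..n}. \<forall>y\<in>{1..n}. \<bar>a\<bar> * \<bar>v x - v y\<bar> \<le> 2 * sqrt (ln (real n))) \<longrightarrow>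
    measure_pmf.prob (random_perm n) {\<pi>. \<bar>perm_sum n w v \<pi> - L\<bar> \<le> 1 / real n}
      \<le> K / real n * exp (\<bar>a\<bar> / real n - a * L) *
         sqrt ((\<Sum>\<pi>\<in>Perms n. exp (2 * a * perm_sum n w v \<pi>)) / fact n))" for K A n
  have "\<exists>A\<^sub>0\<ge>1. \<exists>N\<ge>2. \<exists>K>0. \<forall>A\<ge>A\<^sub>0. \<forall>n\<ge>N. tilted K A n"
    unfolding tilted_def by (rule tilted_local_bound[OF assms])
  then obtain A0 N K where A0: "1 \<le> A0" and N: "2 \<le> N" and K: "0 < K"
    and til: "\<And>A n. A \<ge> A0 \<Longrightarrow> n \<ge> N \<Longrightarrow> tilted K A n" by blast
  show ?thesis
  proof (rule exI[of _ A0], rule conjI, use A0 in simp, intro allI impI conjI)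
    fix A assume A: "A0 \<le> A"
    show "\<exists>K :: real. \<forall>(n :: nat) \<ge> 2. \<forall>(w :: nat \<Rightarrow> real) (I :: nat set) (v :: nat \<Rightarrow> real).
       spread_weights A n w \<and> I \<subseteq> {1..n} \<and> real (card I) \<ge> \<delta> * real n \<and>
       poly_on d b B n I v \<longrightarrow>
       (\<forall>L :: real. measure_pmf.prob (random_perm n) {\<pi>. \<bar>perm_sum n w v \<pi> - L\<bar> \<le> 1 / real n}
          \<le> K / real n)"
    proof (rule exI[of _ "K + real N"], intro allI impI, elim conjE)
      fix n :: nat and w v :: "nat \<Rightarrow> real" and I :: "nat set" and L :: real
      assume n: "2 \<le> n" and h: "spread_weights A n w" "I \<subseteq> {1..n}" "\<delta> * real n \<le> real (card I)" "poly_on d b B n I v"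
      show "measure_pmf.prob (random_perm n) {\<pi>. \<bar>perm_sum n w v \<pi> - L\<bar> \<le> 1 / real n} \<le> (K + real N) / real n"
      proof (cases "N \<le> n")
        case True
        \<comment> \<open>With \<open>a = 0\<close> the tilt condition holds trivially, although the
          values outside \<open>I\<close> may be large, and the exponential sum is
          \<open>fact n\<close>.\<close>
        have "measure_pmf.prob (random_perm n) {\<pi>. \<bar>perm_sum n w v \<pi> - L\<bar> \<le> 1 / real n} \<le> K / real n * exp (\<bar>0\<bar> / real n - 0 * L) *
         sqrt ((\<Sum>\<pi>\<in>Perms n. exp (2 * 0 * perm_sum n w v \<pi>)) / fact n)"
          by (rule til[OF A True, unfolded tilted_def, rule_format, OF h]) (use n in simp)
        also have "\<dots> = K / real n" by (simp add: card_Perms)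
        also have "\<dots> \<le> (K + real N) / real n" by (intro divide_right_mono) auto
        finally show ?thesis .
      next
        case False
        \<comment> \<open>For \<open>n < N\<close> the claimed bound is at least 1; the summand
          \<open>N\<close> of the constant is there for this.\<close>
        then have "1 \<le> (K + real N) / real n" using K n by (simp add: field_simps)
        then show ?thesis using measure_pmf.prob_le_1 order_trans by blast
      qed
    qed
  next
    fix A B' :: real assume A: "A0 \<le> A" and B': "0 < B'"
    \<comment> \<open>After the square root the moment at \<open>2 * a\<close> costs
      \<open>exp (4 * B'^2 * a^2)\<close>; for \<open>a = e * L\<close> this is
      \<open>exp (e * L^2 / 2)\<close>, half of the gain \<open>e * L^2\<close>. Another quarter
      goes to \<open>tilt_error_le\<close>, which leaves the rate \<open>e / 4\<close>.\<close>
    define e where "e = 1 / (8 * B'\<^sup>2)"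
    have e: "0 < e" "8 * B'\<^sup>2 * e = 1" using B' by (auto simp: e_def)
    \<comment> \<open>For \<open>n < N\<close> the sum is at most \<open>N * B'\<close> in absolute
      value and the window has half-width at most 1, so the event is empty once
      \<open>|L| > R\<close>.\<close>
    define R where "R = real N * B' + 1"
    \<comment> \<open>One summand per case: the tilted local bound, the tail, and small
      \<open>n\<close>.\<close>
    define K' where "K' = K * exp e + exp e + real N * exp (e / 4 * R\<^sup>2)"
    have K': "0 < K'" using K by (simp add: K'_def add_pos_nonneg add_pos_pos)
    show "\<exists>(K' :: real) > 0. \<exists>(c :: real) > 0.
       \<forall>(n :: nat) \<ge> 2. \<forall>(w :: nat \<Rightarrow> real) (I :: nat set) (v :: nat \<Rightarrow> real).
       spread_weights A n w \<and> I \<subseteq> {1..n} \<and> real (card I) \<ge> \<delta> * real n \<and>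
       poly_on d b B n I v \<and> (\<forall>i\<in>{1..n}. \<bar>v i\<bar> \<le> B') \<longrightarrow>
       (\<forall>L :: real. measure_pmf.prob (random_perm n) {\<pi>. \<bar>perm_sum n w v \<pi> - L\<bar> \<le> 1 / real n}
          \<le> K' / real n * exp (- c * L\<^sup>2))"
    proof (rule exI[of _ K'], rule conjI[OF K'], rule exI[of _ "e / 4"], rule conjI, use e in simp, intro allI impI, elim conjE)
      fix n :: nat and w v :: "nat \<Rightarrow> real" and I :: "nat set" and L :: real
      assume n: "2 \<le> n" and h: "spread_weights A n w" "I \<subseteq> {1..n}" "\<delta> * real n \<le> real (card I)" "poly_on d b B n I v"
        and vB: "\<forall>i\<in>{1..n}. \<bar>v i\<bar> \<le> B'"
      have n1: "n \<ge> 1" "0 < real n" using n by auto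
      have w: "(\<Sum>i=1..n. w i) = 0" "(\<Sum>i=1..n. (w i)\<^sup>2) = 1" using h(1) by (auto simp: spread_weights_def)
      have v: "\<And>i. i \<in> {1..n} \<Longrightarrow> \<bar>v i\<bar> \<le> B'" using vB by blast
      define G where "G = exp (- (e / 4) * L\<^sup>2)"
      have G0: "0 < G" by (simp add: G_def)
      define pr where "pr = measure_pmf.prob (random_perm n) {\<pi>. \<bar>perm_sum n w v \<pi> - L\<bar> \<le> 1 / real n}"
      have enough: "pr \<le> K' / real n * G" if "pr \<le> X / real n * G" "X \<le> K'" for X
      proof -
        have "X / real n * G \<le> K' / real n * G" using that G0 n1 by (intro mult_right_mono divide_right_mono) auto
        then show ?thesis using that by linarith
      qed
      have "pr \<le> K' / real n * G"
      proof (cases "N \<le> n")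
        case small: False
        show ?thesis
        proof (rule enough)
          show "real N * exp (e / 4 * R\<^sup>2) \<le> K'" using K by (simp add: K'_def)
          show "pr \<le> real N * exp (e / 4 * R\<^sup>2) / real n * G"
          proof (cases "\<bar>L\<bar> \<le> R")
            case True
            then have "L\<^sup>2 \<le> R\<^sup>2" by (metis abs_ge_zero power2_abs power_mono)
            then have "exp 0 \<le> exp (e / 4 * R\<^sup>2 + - (e / 4) * L\<^sup>2)" using e by (simp add: algebra_simps)
            then have g: "1 \<le> exp (e / 4 * R\<^sup>2) * G" by (simp only: exp_zero exp_add G_def)
            have "1 \<le> real N / real n" using small n1 by simp
            with g have "1 * 1 \<le> real N / real n * (exp (e / 4 * R\<^sup>2) * G)" by (intro mult_mono) auto
            moreover have "pr \<le> 1" by (simp add: pr_def)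
            ultimately show ?thesis by simp
          next
            case False
            have "{\<pi>\<in>Perms n. \<bar>perm_sum n w v \<pi> - L\<bar> \<le> 1 / real n} = {}"
            proof -
              have "\<bar>perm_sum n w v \<pi>\<bar> \<le> real N * B'" if "\<pi> \<in> Perms n" for \<pi>
              proof -
                have "real n * B' \<le> real N * B'" using small B' by (intro mult_right_mono) auto
                then show ?thesis using perm_sum_abs_le[OF w(2) _ that, of v B'] v by fastforce
              qed
              moreover have "1 / real n \<le> 1" using n1 by simp
              ultimately show ?thesis using False by (fastforce simp: R_def)
            qed
            then have "pr = 0" by (simp add: pr_def prob_random_perm)
            then show ?thesis using G0 by simp
          qed
        qed
      next
        case big: True
        have KX: "K * exp e \<le> K'" "exp e \<le> K'" using K by (auto simp: K'_def)
        show ?thesis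
        proof (cases "4 * ln (real n) \<le> e * L\<^sup>2")
          case True
          from gaussian_tail[OF n1(1) w v e True] show ?thesis
            by (intro enough[OF _ KX(2)]) (simp add: pr_def G_def)
        next
          case False
          \<comment> \<open>Here \<open>e * L^2 < 4 * ln n\<close>, which makes \<open>e * L\<close>
            an admissible tilt: \<open>(a * B')^2 = e * L^2 / 8 \<le> ln n\<close>.\<close>
          define a where "a = e * L"
          have "\<bar>a\<bar> * (2 * B') \<le> 2 * sqrt (ln (real n))"
          proof -
            have "(\<bar>a\<bar> * B')\<^sup>2 = a\<^sup>2 * B'\<^sup>2" by (simp add: power_mult_distrib)
            also have "\<dots> = (8 * B'\<^sup>2 * e) * (e * L\<^sup>2 / 8)" by (simp add: a_def power2_eq_square)
            also have "\<dots> = e * L\<^sup>2 / 8" using e by simp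
            also have "\<dots> \<le> ln (real n)"
            proof -
              have "0 \<le> ln (real n)" using n1 by simp
              then show ?thesis using False by linarith
            qed
            finally have "\<bar>a\<bar> * B' \<le> sqrt (ln (real n))" by (rule real_le_rsqrt)
            then show ?thesis by simp
          qed
          moreover have "\<bar>a\<bar> * \<bar>v x - v y\<bar> \<le> \<bar>a\<bar> * (2 * B')" if "x \<in> {1..n}" "y \<in> {1..n}" for x y
            using v[OF that(1)] v[OF that(2)] by (intro mult_left_mono) auto
          ultimately have tl: "\<bar>a\<bar> * \<bar>v x - v y\<bar> \<le> 2 * sqrt (ln (real n))" if "x \<in> {1..n}" "y \<in> {1..n}" for x y
            using that order_trans by blast
          have "pr \<le> K / real n * exp (\<bar>a\<bar> / real n - a * L) * sqrt ((\<Sum>\<pi>\<in>Perms n. exp (2 * a * perm_sum n w v \<pi>)) / fact n)"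
            unfolding pr_def by (rule til[OF A big, unfolded tilted_def, rule_format, OF h tl])
          also have "\<dots> \<le> K / real n * exp (\<bar>a\<bar> / real n - a * L) * exp (e * L\<^sup>2 / 2)"
          proof (rule mult_left_mono)
            have "(\<Sum>\<pi>\<in>Perms n. exp (2 * a * perm_sum n w v \<pi>)) \<le> fact n * exp (2 * B'\<^sup>2 * (2 * a)\<^sup>2)"
              by (rule subgaussian[OF n1(1) w v])
            then have "(\<Sum>\<pi>\<in>Perms n. exp (2 * a * perm_sum n w v \<pi>)) / fact n \<le> exp (2 * B'\<^sup>2 * (2 * a)\<^sup>2)"
              by (simp add: field_simps)
            also have "2 * B'\<^sup>2 * (2 * a)\<^sup>2 = (8 * B'\<^sup>2 * e) * (e * L\<^sup>2)" by (simp add: a_def power2_eq_square)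
            also have "\<dots> = 2 * (e * L\<^sup>2 / 2)" using e by simp
            also have "exp \<dots> = (exp (e * L\<^sup>2 / 2))\<^sup>2" by (rule exp_double)
            finally show "sqrt ((\<Sum>\<pi>\<in>Perms n. exp (2 * a * perm_sum n w v \<pi>)) / fact n) \<le> exp (e * L\<^sup>2 / 2)"
              by (intro real_le_lsqrt) auto
            show "0 \<le> K / real n * exp (\<bar>a\<bar> / real n - a * L)" using K by simp
          qed
          also have "\<dots> = K / real n * exp (\<bar>a\<bar> / real n - a * L + e * L\<^sup>2 / 2)" by (simp add: exp_add)
          also have "\<dots> \<le> K / real n * exp (e + - (e / 4) * L\<^sup>2)"
          proof -
            have "\<bar>a\<bar> / real n \<le> e * L\<^sup>2 / 4 + e" unfolding a_def by (rule tilt_error_le) (use e n in auto)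
            moreover have "a * L = e * L\<^sup>2" by (simp add: a_def power2_eq_square)
            ultimately have "\<bar>a\<bar> / real n - a * L + e * L\<^sup>2 / 2 \<le> e - e * L\<^sup>2 / 4" by linarith
            then have "\<bar>a\<bar> / real n - a * L + e * L\<^sup>2 / 2 \<le> e + - (e / 4) * L\<^sup>2" by simp
            then show ?thesis using K by (intro mult_left_mono) auto
          qed
          also have "\<dots> = K * exp e / real n * G" unfolding exp_add G_def by simp
          finally show ?thesis by (rule enough[OF _ KX(1)])
        qed
      qed
      then show "measure_pmf.prob (random_perm n) {\<pi>. \<bar>perm_sum n w v \<pi> - L\<bar> \<le> 1 / real n} \<le> K' / real n * exp (- (e / 4) * L\<^sup>2)"
        by (simp add: pr_def G_def)
    qed
  qed
qed

end
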